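(* Let $(J_1,W_1)$ and $(J_2,W_2)$ be pure graphons and let $\alpha_1=(\alpha_{1,1},\dots,\alpha_{1,k})\in J_1^k$, $\alpha_2=(\alpha_{2,1},\dots,\alpha_{2,k})\in J_2^k$. Then there exists a measure preserving bijection $\varphi:J_1\to J_2$ such that $W_2(\varphi(x),\varphi(y))=W_1(x,y)$ for almost all $(x,y)$ and $\varphi(\alpha_{1,i})=\alpha_{2,i}$ for all $i\le k$ if and only if $t_{\alpha_1}(F,W_1)=t_{\alpha_2}(F,W_2)$ for every $k$-labeled simple graph $F$.
   Context: A graphon is a pair $(J,W)$ where $J$ is a standard probability space with probability measure $\pi$ and $W:J\times J\to[0,1]$ is a symmetric measurable function with every section $W(x,\cdot)$ measurable. $r_W(x,y)=\int_J|W(x,z)-W(y,z)|\,d\pi(z)$. The graphon is pure if $r_W$ is a metric on $J$, $(J,r_W)$ is complete, and $\pi$ has full support. A $k$-labeled graph $F=(V,E)$ has $k$ distinct nodes labeled $1,\dots,k$ (identified with $[k]\subseteq V$); edges between labeled nodes are allowed. For $x=(x_1,\dots,x_k)\in J^k$, $t_{x}(F,W)=\int_{J^{V\setminus[k]}}\prod_{ij\in E}W(x_i,x_j)\prod_{i\in V\setminus[k]}d\pi(x_i)$.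
   Formalization: φ must also satisfy W2(φ(α_{1,i}),φ(y))=W1(α_{1,i},y) for almost all y, for each i, and W2(φ(α_{1,i}),φ(α_{1,j}))=W1(α_{1,i},α_{1,j}) for i≠j; without this "only if" fails (W=xy on [0,1], φ swapping 0 and 1, α1=0, α2=1). *)

theory Defs
  imports "HOL-Probability.Probability"
begin

definition measure_preserving_bij :: "'a measure \<Rightarrow> 'b measure \<Rightarrow> ('a \<Rightarrow> 'b) \<Rightarrow> bool" where
  "measure_preserving_bij M N f \<longleftrightarrow>
     bij_betw f (space M) (space N) \<and>
     f \<in> measurable M N \<and> the_inv_into (space M) f \<in> measurable N M \<and>
     distr M N f = N"

definition isomorphic_mod_0 :: "'a measure \<Rightarrow> 'b measure \<Rightarrow> bool" where
  "isomorphic_mod_0 M N \<longleftrightarrow>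
     (\<exists>A\<in>sets M. \<exists>B\<in>sets N.
        space M - A \<in> null_sets M \<and> space N - B \<in> null_sets N \<and>
        (\<exists>f. measure_preserving_bij (restrict_space M A) (restrict_space N B) f))"

text \<open>
  Standard probability spaces in the sense of Lebesgue and Rokhlin: complete probability spaces
  that are isomorphic mod 0 to the completion of a Borel probability measure on the real line.
  (Up to isomorphism mod 0 the latter are exactly the disjoint unions of an interval with Lebesgue
  measure and countably many atoms.)
\<close>
definition standard_prob_space :: "'a measure \<Rightarrow> bool" where
  "standard_prob_space M \<longleftrightarrow>
     prob_space M \<and> complete_measure M \<and>
     (\<exists>N :: real measure. prob_space N \<and> sets N = sets borel \<and> isomorphic_mod_0 M (completion N))"

text \<open>
  Joint measurability is Lebesgue measurability, that is, with respect to the completed product.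
  This is why measurability of every section is a separate requirement.
\<close>
locale graphon =
  fixes M :: "'a measure" and W :: "'a \<Rightarrow> 'a \<Rightarrow> real"
  assumes standard: "standard_prob_space M"
    and measurable_W: "(\<lambda>(x, y). W x y) \<in> borel_measurable (completion (M \<Otimes>\<^sub>M M))"
    and measurable_section: "\<And>x. x \<in> space M \<Longrightarrow> W x \<in> borel_measurable M"
    and symmetric: "\<And>x y. x \<in> space M \<Longrightarrow> y \<in> space M \<Longrightarrow> W x y = W y x"
    and range_W: "\<And>x y. x \<in> space M \<Longrightarrow> y \<in> space M \<Longrightarrow> W x y \<in> {0..1}"

definition graphon_dist :: "'a measure \<Rightarrow> ('a \<Rightarrow> 'a \<Rightarrow> real) \<Rightarrow> 'a \<Rightarrow> 'a \<Rightarrow> real" where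
  "graphon_dist M W x y = (\<integral>z. \<bar>W x z - W y z\<bar> \<partial>M)"

locale pure_graphon = graphon M W + Metric_space "space M" "graphon_dist M W"
  for M :: "'a measure" and W :: "'a \<Rightarrow> 'a \<Rightarrow> real" +
  assumes complete: "mcomplete"
    and full_support: "\<And>U. openin mtopology U \<Longrightarrow> U \<noteq> {} \<Longrightarrow> emeasure M U > 0"

text \<open>
  A finite simple graph with node set \<open>V\<close> and edge set \<open>E\<close>, whose labeled nodes are
  the numbers \<open>1, \<dots>, k\<close> themselves. Since only isomorphism types matter, all nodes are
  taken to be natural numbers.
\<close>
definition labeled_simple_graph :: "nat \<Rightarrow> nat set \<Rightarrow> nat set set \<Rightarrow> bool" where
  "labeled_simple_graph k V E \<longleftrightarrow>
     finite V \<and> {1..k} \<subseteq> V \<and> E \<subseteq> {{i, j} | i j. i \<in> V \<and> j \<in> V \<and> i \<noteq> j}"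

text \<open>
  The product over edges picks the orientation \<open>i < j\<close> of each edge, which is immaterial as
  \<open>W\<close> is symmetric. The product measure is completed because \<open>W\<close> is only Lebesgue measurable.
\<close>
definition labeled_density ::
  "'a measure \<Rightarrow> ('a \<Rightarrow> 'a \<Rightarrow> real) \<Rightarrow> nat \<Rightarrow> (nat \<Rightarrow> 'a) \<Rightarrow> nat set \<Rightarrow> nat set set \<Rightarrow> real" where
  "labeled_density M W k a V E =
     (\<integral>x. (let p = (\<lambda>i. if i \<in> {1..k} then a i else x i)
            in \<Prod>(i, j) \<in> {(i, j). i < j \<and> {i, j} \<in> E}. W (p i) (p j))
      \<partial>completion (\<Pi>\<^sub>M i \<in> V - {1..k}. M))"

text \<open>
  Equality of \<open>W\<^sub>2 (\<phi> x) (\<phi> y)\<close> and \<open>W\<^sub>1 x y\<close> for almost all pairs says nothing about pairs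
  that involve one of the finitely many prescribed points, whereas labeled densities do depend on
  the values there. The following condition is what "almost all" has to mean at
  these points.

  It cannot be dropped. (1) Let \<open>W\<^sub>1 x y = W\<^sub>2 x y = x * y\<close> on the unit interval, a pure graphon, and
  let \<open>\<phi>\<close> swap \<open>0\<close> and \<open>1\<close> and fix all other points. Then \<open>\<phi>\<close> preserves the graphon almost
  everywhere, but the points \<open>0\<close> and \<open>1\<close> have different degrees. (2) Let \<open>\<phi>\<close> be the identity and
  let \<open>W\<^sub>2\<close> arise from \<open>W\<^sub>1\<close> by changing the value to \<open>0\<close> at \<open>(1/2, 1/3)\<close> and \<open>(1/3, 1/2)\<close>. Then
  \<open>W\<^sub>2\<close> is still pure, but the densities of an edge between two labels put at these points differ.
\<close>
definition agree_at_roots ::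
  "'a measure \<Rightarrow> ('a \<Rightarrow> 'a \<Rightarrow> real) \<Rightarrow> ('b \<Rightarrow> 'b \<Rightarrow> real) \<Rightarrow> nat \<Rightarrow> (nat \<Rightarrow> 'a) \<Rightarrow> ('a \<Rightarrow> 'b) \<Rightarrow> bool" where
  "agree_at_roots M1 W1 W2 k a \<phi> \<longleftrightarrow>
     (\<forall>i\<in>{1..k}. AE y in M1. W2 (\<phi> (a i)) (\<phi> y) = W1 (a i) y) \<and>
     (\<forall>i\<in>{1..k}. \<forall>j\<in>{1..k}. i \<noteq> j \<longrightarrow> W2 (\<phi> (a i)) (\<phi> (a j)) = W1 (a i) (a j))"

end

theory Submission
  imports Defs
begin

text \<open>
  The idea is to replace \<open>W\<close> by codegrees \<open>c x y = \<integral> W x z * W y z dz\<close>. Products of codegrees of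
  distinct points are densities of simple graphs without edges between the roots, and
  \<open>sup\<^sub>u \<bar>c x u - c y u\<bar>\<close> is uniformly equivalent to \<open>r\<^sub>W\<close>.

  Suppose the densities agree at the first \<open>n\<close> roots. As functions of one further root, the
  densities in both graphons have the same joint moments, hence (Stone--Weierstrass on the cube)
  the same joint distribution. In a standard probability space the image of a set of positive
  measure contains a compact set of almost the same measure, so the two images meet, and a new root
  can be chosen in any prescribed ball of one graphon together with a partner in the other one.
  A back-and-forth choice yields sequences \<open>X\<close>, \<open>Y\<close> with dense tails and equal densities. By the
  uniform equivalence above and completeness, \<open>X i \<mapsto> Y i\<close> extends to a bijection preserving
  codegrees. The codegree profiles \<open>x \<mapsto> (c (X i) x)\<^sub>i\<close> are injective with equal distributions,
  which makes the bijection measure preserving; moments weighted by \<open>W (X i)\<close> show that it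
  transports the sections \<open>W (X i)\<close>, hence by density all sections.
\<close>

section \<open>Moments determine distributions on the cube\<close>

text \<open>Only simple graphs are available, and this decides what can be measured at a point
  \<open>x\<close>. The values \<open>W (X i) x\<close> cannot serve as coordinates: their powers
  would be multiple edges, and at a pair of roots they may be arbitrary, since the pair can be a
  null set. A codegree spends a fresh middle node on every use, so all its powers are densities of
  simple graphs. Only the codegree of a root with itself fails, being a double edge; dense tails
  recover it as a limit. A moment of codegrees still has room for one extra factor
  \<open>W (X i)\<close>, which is just enough to recover a whole section, as the density of a
  weighted measure.

  The second obstacle is that the probability spaces are complete. Their measurable sets need not be
  preimages of Borel sets under the profiles, and images of measurable sets need not be Borel. Every
  transfer between the spaces therefore rests on a Borel set inside the image that carries at least
  the mass of the original set.\<close>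

inductive poly_fun :: "(('i \<Rightarrow> real) \<Rightarrow> real) \<Rightarrow> bool" where
  poly_fun_monom: "poly_fun (\<lambda>v. c * (\<Prod>l\<leftarrow>ls. v l))"
| poly_fun_add: "poly_fun f \<Longrightarrow> poly_fun g \<Longrightarrow> poly_fun (\<lambda>v. f v + g v)"

text \<open>Lists may repeat an index, so powers need no exponents and appending two lists
  multiplies monomials. With this closure \<open>poly_fun\<close> is an algebra to which
  Stone--Weierstrass applies.\<close>

lemma poly_fun_mult:
  assumes "poly_fun f" "poly_fun g"
  shows "poly_fun (\<lambda>v. f v * g v)"
  using assms(1)
proof induction
  case (poly_fun_monom c ls)
  show ?case
    using assms(2)
  proof induction
    case (poly_fun_monom d ms)
    show ?case
      using poly_fun.poly_fun_monom[of "c * d" "ls @ ms"] by (simp add: mult_ac)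
  next
    case (poly_fun_add g h)
    then show ?case
      using poly_fun.poly_fun_add by (fastforce simp: distrib_left)
  qed
next
  case (poly_fun_add f h)
  then show ?case
    using poly_fun.poly_fun_add by (fastforce simp: distrib_right)
qed

lemma prod_list_unit_interval:
  assumes "\<And>l. l \<in> set ls \<Longrightarrow> (v l :: real) \<in> {0..1}"
  shows "(\<Prod>l\<leftarrow>ls. v l) \<in> {0..1}"
  using assms by (induction ls) (auto intro: mult_le_one)

lemma continuous_on_prod_list:
  fixes f :: "'i \<Rightarrow> 'a::topological_space \<Rightarrow> real"
  assumes "\<And>l. continuous_on S (f l)"
  shows "continuous_on S (\<lambda>v. \<Prod>l\<leftarrow>ls. f l v)"
  by (induction ls) (auto intro!: continuous_intros assms)

lemma continuous_on_poly_fun: "poly_fun f \<Longrightarrow> continuous_on S f"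
proof (induction rule: poly_fun.induct)
  case (poly_fun_monom c ls)
  have "continuous_on S (\<lambda>v :: 'a \<Rightarrow> real. v l)" for l
    by (rule continuous_on_subset[OF continuous_on_product_coordinates subset_UNIV])
  then show ?case
    by (intro continuous_on_mult continuous_on_const continuous_on_prod_list)
qed (rule continuous_on_add)

lemma measurable_prod_list:
  fixes f :: "'i \<Rightarrow> 'a \<Rightarrow> real"
  assumes "\<And>l. l \<in> set ls \<Longrightarrow> f l \<in> borel_measurable M"
  shows "(\<lambda>x. \<Prod>l\<leftarrow>ls. f l x) \<in> borel_measurable M"
  using assms by (induction ls) auto

lemma (in finite_measure) integrable_unit_interval:
  fixes f :: "'a \<Rightarrow> real"
  assumes "f \<in> borel_measurable M" "\<And>x. x \<in> space M \<Longrightarrow> f x \<in> {0..1}"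
  shows "integrable M f"
  by (rule integrable_const_bound[where B = 1]) (use assms in auto)

lemma measurable_coordinate:
  fixes f :: "'a \<Rightarrow> 'i::countable \<Rightarrow> real"
  assumes "f \<in> borel_measurable M"
  shows "(\<lambda>x. f x i) \<in> borel_measurable M"
  using assms by (rule measurable_product_then_coordinatewise)

text \<open>Linearity extends the equality from monomials to sums; integrability is carried through
  the induction because additivity of the integral needs it.\<close>

lemma integral_poly_fun_eq:
  fixes f :: "'a \<Rightarrow> 'i::countable \<Rightarrow> real" and g :: "'b \<Rightarrow> 'i \<Rightarrow> real"
  assumes "finite_measure M" "finite_measure N"
    and f: "f \<in> borel_measurable M" and g: "g \<in> borel_measurable N"
    and f01: "\<And>x i. x \<in> space M \<Longrightarrow> f x i \<in> {0..1}"
    and g01: "\<And>x i. x \<in> space N \<Longrightarrow> g x i \<in> {0..1}"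
    and eq: "\<And>ls. (\<integral>x. (\<Prod>l\<leftarrow>ls. f x l) \<partial>M) = (\<integral>x. (\<Prod>l\<leftarrow>ls. g x l) \<partial>N)"
    and "poly_fun p"
  shows "integrable M (\<lambda>x. p (f x)) \<and> integrable N (\<lambda>x. p (g x)) \<and>
    (\<integral>x. p (f x) \<partial>M) = (\<integral>x. p (g x) \<partial>N)"
proof -
  interpret M: finite_measure M by fact
  interpret N: finite_measure N by fact
  have "integrable M (\<lambda>x. \<Prod>l\<leftarrow>ls. f x l)" "integrable N (\<lambda>x. \<Prod>l\<leftarrow>ls. g x l)" for ls
    by (intro M.integrable_unit_interval N.integrable_unit_interval measurable_prod_list
        measurable_coordinate f g prod_list_unit_interval f01 g01; assumption)+
  with \<open>poly_fun p\<close> show ?thesis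
    by induction (auto simp: eq)
qed

text \<open>Tychonoff, for the product topology on the function type.\<close>

lemma compact_cube: "compact {v :: 'i::countable \<Rightarrow> real. \<forall>i. v i \<in> {0..1}}"
proof -
  have "compactin (product_topology (\<lambda>i::'i. euclidean) UNIV) (PiE UNIV (\<lambda>i::'i. {0..1::real}))"
    unfolding compactin_PiE by auto
  then show ?thesis
    by (simp add: euclidean_product_topology PiE_def Pi_def)
qed

lemma moments_determine_distr:
  fixes f :: "'a \<Rightarrow> 'i::countable \<Rightarrow> real" and g :: "'b \<Rightarrow> 'i \<Rightarrow> real"
  assumes "finite_measure M" "finite_measure N"
    and f: "f \<in> borel_measurable M" and g: "g \<in> borel_measurable N"
    and f01: "\<And>x i. x \<in> space M \<Longrightarrow> f x i \<in> {0..1}"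
    and g01: "\<And>x i. x \<in> space N \<Longrightarrow> g x i \<in> {0..1}"
    and eq: "\<And>ls. (\<integral>x. (\<Prod>l\<leftarrow>ls. f x l) \<partial>M) = (\<integral>x. (\<Prod>l\<leftarrow>ls. g x l) \<partial>N)"
  shows "distr M borel f = distr N borel g"
proof -
  interpret M: finite_measure M by fact
  interpret N: finite_measure N by fact
  interpret Mf: finite_measure "distr M borel f" by (rule M.finite_measure_distr[OF f])
  interpret Ng: finite_measure "distr N borel g" by (rule N.finite_measure_distr[OF g])
  let ?S = "{v :: 'i \<Rightarrow> real. \<forall>i. v i \<in> {0..1}}"
  let ?F = "distr M borel f" and ?G = "distr N borel g"
  have cont_eq: "(\<integral>x. h (f x) \<partial>M) = (\<integral>x. h (g x) \<partial>N)"
    if h: "continuous_on UNIV h" "\<And>v. h v \<in> {0..1}" for h :: "('i \<Rightarrow> real) \<Rightarrow> real"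
  proof -
    have hm: "h \<in> borel_measurable borel"
      using h(1) by (rule borel_measurable_continuous_onI)
    have ih: "integrable M (\<lambda>x. h (f x))" "integrable N (\<lambda>x. h (g x))"
      by (intro M.integrable_unit_interval N.integrable_unit_interval h(2)
          measurable_compose[OF f hm] measurable_compose[OF g hm])+
    \<comment> \<open>A uniform error \<open>e\<close> on the cube costs at most \<open>e\<close>
      times the total mass on either side.\<close>
    let ?C = "measure M (space M) + measure N (space N)"
    have "\<bar>(\<integral>x. h (f x) \<partial>M) - (\<integral>x. h (g x) \<partial>N)\<bar> \<le> e * ?C" if "e > 0" for e
    proof -
      have "\<exists>p. poly_fun p \<and> (\<forall>v\<in>?S. \<bar>h v - p v\<bar> < e)"
      proof (rule Stone_Weierstrass_HOL[where P = poly_fun and S = ?S])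
        show "compact ?S" by (rule compact_cube)
        show "poly_fun (\<lambda>x. c)" for c using poly_fun_monom[of c "[]"] by simp
        show "continuous_on ?S f" if "poly_fun f" for f using that by (rule continuous_on_poly_fun)
        show "poly_fun (\<lambda>x. f x + g x)" if "poly_fun f \<and> poly_fun g" for f g
          using that by (auto intro: poly_fun_add)
        show "poly_fun (\<lambda>x. f x * g x)" if "poly_fun f \<and> poly_fun g" for f g
          using that by (auto intro: poly_fun_mult)
        show "\<exists>f. poly_fun f \<and> f x \<noteq> f y" if "x \<in> ?S \<and> y \<in> ?S \<and> x \<noteq> y" for x y
        proof -
          from that have "x \<noteq> y" by simp
          then obtain l where "x l \<noteq> y l" by (auto simp: fun_eq_iff)
          moreover have "poly_fun (\<lambda>v. v l)" using poly_fun_monom[of 1 "[l]"] by simp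
          ultimately show ?thesis by blast
        qed
        show "continuous_on ?S h" using h(1) by (rule continuous_on_subset) auto
      qed (fact that)
      then obtain p where p: "poly_fun p" "\<And>v. v \<in> ?S \<Longrightarrow> \<bar>h v - p v\<bar> < e" by blast
      note ip = integral_poly_fun_eq[OF assms p(1)]
      have pM: "\<bar>h (f x) - p (f x)\<bar> \<le> e" if "x \<in> space M" for x
        using p(2)[of "f x"] f01[OF that] by auto
      have pN: "\<bar>h (g x) - p (g x)\<bar> \<le> e" if "x \<in> space N" for x
        using p(2)[of "g x"] g01[OF that] by auto
      have "\<bar>\<integral>x. h (f x) - p (f x) \<partial>M\<bar> \<le> (\<integral>x. \<bar>h (f x) - p (f x)\<bar> \<partial>M)"
        by (rule integral_abs_bound)
      also have "\<dots> \<le> (\<integral>x. e \<partial>M)"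
        by (rule integral_mono) (use ih ip pM in auto)
      finally have 1: "\<bar>\<integral>x. h (f x) - p (f x) \<partial>M\<bar> \<le> e * measure M (space M)" by (simp add: mult.commute)
      have "\<bar>\<integral>x. h (g x) - p (g x) \<partial>N\<bar> \<le> (\<integral>x. \<bar>h (g x) - p (g x)\<bar> \<partial>N)"
        by (rule integral_abs_bound)
      also have "\<dots> \<le> (\<integral>x. e \<partial>N)"
        by (rule integral_mono) (use ih ip pN in auto)
      finally have 2: "\<bar>\<integral>x. h (g x) - p (g x) \<partial>N\<bar> \<le> e * measure N (space N)" by (simp add: mult.commute)
      from 1 2 show ?thesis
        using ih ip by (simp add: distrib_left)
    qed
    note bound = this
    \<comment> \<open>The \<open>+ 1\<close> keeps the divisor positive even if both measures
      vanish.\<close>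
    have aux: "d / (c + 1) * c \<le> d" if "c \<ge> 0" "d > 0" for c d :: real
      using that by (simp add: divide_le_eq distrib_left)
    have "?C \<ge> 0" by simp
    have "\<bar>(\<integral>x. h (f x) \<partial>M) - (\<integral>x. h (g x) \<partial>N)\<bar> \<le> 0 + e" if "e > 0" for e
    proof -
      have "e / (?C + 1) * ?C \<le> e"
        using aux[OF \<open>?C \<ge> 0\<close> that] .
      moreover have "e / (?C + 1) > 0"
        using that \<open>?C \<ge> 0\<close> by (intro divide_pos_pos) linarith+
      ultimately show ?thesis
        using bound[of "e / (?C + 1)"] by simp
    qed
    then have "\<bar>(\<integral>x. h (f x) \<partial>M) - (\<integral>x. h (g x) \<partial>N)\<bar> \<le> 0"
      by (rule field_le_epsilon)
    then show ?thesis by simp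
  qed
  have closed_eq: "emeasure ?F C = emeasure ?G C" if "closed C" for C
  \<comment> \<open>\<open>infdist\<close> to the empty set is 0 by convention, so the functions
    \<open>h n\<close> below would not tend to its indicator.\<close>
  proof (cases "C = {}")
    case False
    define h where "h n v = max 0 (1 - real n * infdist v C)" for n v
    have h: "continuous_on UNIV (h n)" "\<And>v. h n v \<in> {0..1}" for n
      unfolding h_def by (auto intro!: continuous_intros continuous_on_infdist simp: infdist_nonneg)
    have hm: "h n \<in> borel_measurable borel" for n
      using h(1) by (rule borel_measurable_continuous_onI)
    have C: "C \<in> sets borel" using that by simp
    have lim: "(\<lambda>n. h n v) \<longlonglongrightarrow> indicator C v" for v
    proof (cases "v \<in> C")
      case True
      then show ?thesis by (simp add: h_def)
    next
      case notin: False
      then have pos: "infdist v C > 0"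
        using in_closed_iff_infdist_zero[OF \<open>closed C\<close> \<open>C \<noteq> {}\<close>] infdist_nonneg[of v C]
        by (metis order_le_less)
      obtain n0 where "1 < real n0 * infdist v C"
        using reals_Archimedean3[OF pos] by blast
      then have "h n v = 0" if "n \<ge> n0" for n
        using mult_right_mono[of "real n0" "real n" "infdist v C"] that pos \<open>1 < real n0 * infdist v C\<close>
        unfolding h_def by linarith
      then have "eventually (\<lambda>n. h n v = 0) sequentially"
        using eventually_sequentially by blast
      then show ?thesis
        using notin by (simp add: tendsto_eventually)
    qed
    have F: "(\<lambda>n. \<integral>v. h n v \<partial>?F) \<longlonglongrightarrow> (\<integral>v. indicat_real C v \<partial>?F)"
      by (rule integral_dominated_convergence[where w = "\<lambda>_. 1"]) (use hm h(2) lim C in auto)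
    have G: "(\<lambda>n. \<integral>v. h n v \<partial>?G) \<longlonglongrightarrow> (\<integral>v. indicat_real C v \<partial>?G)"
      by (rule integral_dominated_convergence[where w = "\<lambda>_. 1"]) (use hm h(2) lim C in auto)
    have "(\<integral>v. h n v \<partial>?F) = (\<integral>v. h n v \<partial>?G)" for n
      using cont_eq[OF h] by (simp add: integral_distr f g hm)
    then have "(\<integral>v. indicat_real C v \<partial>?F) = (\<integral>v. indicat_real C v \<partial>?G)"
      using G by (intro LIMSEQ_unique[OF F]) simp
    then show ?thesis
      using C by (simp add: Mf.emeasure_eq_measure Ng.emeasure_eq_measure)
  qed auto
  show ?thesis
  proof (rule measure_eqI_generator_eq[where E = "Collect closed" and \<Omega> = UNIV and A = "\<lambda>_. UNIV"])
    show "Int_stable (Collect closed :: ('i \<Rightarrow> real) set set)"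
      by (auto simp: Int_stable_def)
    show "sets ?F = sigma_sets UNIV (Collect closed)" "sets ?G = sigma_sets UNIV (Collect closed)"
      by (simp_all add: borel_eq_closed)
    show "emeasure ?F X = emeasure ?G X" if "X \<in> Collect closed" for X
      using that closed_eq by simp
  qed auto
qed

section \<open>Compact images in standard probability spaces\<close>

text \<open>The inverse of an isomorphism mod 0 is measurable, so images of measurable sets are
  measurable for the completed measure on the line: Borel up to a subset of a Borel null set, whose
  preimage is null. Extension by 0 off \<open>A0\<close> makes the coordinate total, at the price of
  injectivity on \<open>A0\<close> only.\<close>

lemma standard_prob_space_real_coordinate:
  assumes "standard_prob_space M"
  obtains A0 and g :: "'a \<Rightarrow> real" where "A0 \<in> sets M" "space M - A0 \<in> null_sets M"
    "g \<in> borel_measurable M" "inj_on g A0"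
    "\<And>A. A \<in> sets M \<Longrightarrow> A \<subseteq> A0 \<Longrightarrow> \<exists>B\<in>sets borel. B \<subseteq> g ` A \<and> A - g -` B \<in> null_sets M"
proof -
  interpret prob_space M using assms by (simp add: standard_prob_space_def)
  interpret complete_measure M using assms by (simp add: standard_prob_space_def)
  from assms obtain N :: "real measure" and A0 B0 f where
    N: "sets N = sets borel" and A0: "A0 \<in> sets M" "space M - A0 \<in> null_sets M"
    and B0: "B0 \<in> sets (completion N)"
    and f: "measure_preserving_bij (restrict_space M A0) (restrict_space (completion N) B0) f"
    unfolding standard_prob_space_def isomorphic_mod_0_def by blast
  have spN: "space N = UNIV"
    using sets_eq_imp_space_eq[OF N] by simp
  have spA: "space (restrict_space M A0) = A0"
    using A0(1) sets.sets_into_space by (auto simp: space_restrict_space)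
  have spB: "space (restrict_space (completion N) B0) = B0"
    by (auto simp: space_restrict_space spN)
  from f have bij: "bij_betw f A0 B0"
    and fm: "f \<in> measurable (restrict_space M A0) (restrict_space (completion N) B0)"
    and im: "the_inv_into A0 f \<in> measurable (restrict_space (completion N) B0) (restrict_space M A0)"
    and df: "distr (restrict_space M A0) (restrict_space (completion N) B0) f = restrict_space (completion N) B0"
    unfolding measure_preserving_bij_def spA spB by auto
  have setsA: "X \<in> sets (restrict_space M A0) \<longleftrightarrow> X \<in> sets M \<and> X \<subseteq> A0" for X
    using A0(1) sets.sets_into_space by (subst sets_restrict_space_iff) auto
  have setsB: "X \<in> sets (restrict_space (completion N) B0) \<longleftrightarrow> X \<in> sets (completion N) \<and> X \<subseteq> B0" for X
    using B0 by (subst sets_restrict_space_iff) (auto simp: spN)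
  have f_vim: "f -` Y \<inter> A0 \<in> sets M" if "Y \<in> sets (completion N)" for Y
  proof -
    have "Y \<inter> B0 \<in> sets (restrict_space (completion N) B0)"
      using that B0 by (simp add: setsB)
    from measurable_sets[OF fm this] have "f -` (Y \<inter> B0) \<inter> A0 \<in> sets M"
      by (simp add: setsA spA)
    also have "f -` (Y \<inter> B0) \<inter> A0 = f -` Y \<inter> A0"
      using bij by (auto simp: bij_betw_def)
    finally show ?thesis .
  qed
  define g where "g x = (if x \<in> A0 then f x else 0)" for x
  have "f \<in> borel_measurable (restrict_space M A0)"
  proof (rule borel_measurableI)
    fix S :: "real set" assume "open S"
    then have "S \<in> sets (completion N)"
      by (intro sets_completionI_sets) (simp add: N)
    then show "f -` S \<inter> space (restrict_space M A0) \<in> sets (restrict_space M A0)"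
      using f_vim by (auto simp: setsA spA)
  qed
  then have gm: "g \<in> borel_measurable M"
    unfolding g_def using A0(1) sets.sets_into_space
    by (subst measurable_restrict_space_iff[symmetric]) auto
  have gf: "g ` A = f ` A" if "A \<subseteq> A0" for A
    using that by (auto simp: g_def intro!: image_cong)
  have "\<exists>B\<in>sets borel. B \<subseteq> g ` A \<and> A - g -` B \<in> null_sets M" if A: "A \<in> sets M" "A \<subseteq> A0" for A
  proof -
    have "the_inv_into A0 f -` A \<inter> B0 \<in> sets (completion N)"
      using measurable_sets[OF im, of A] A by (simp add: setsA setsB spB)
    also have "the_inv_into A0 f -` A \<inter> B0 = f ` A"
    proof (intro equalityI subsetI)
      fix y assume "y \<in> the_inv_into A0 f -` A \<inter> B0"
      then show "y \<in> f ` A"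
        using f_the_inv_into_f[of f A0 y] bij by (metis IntD1 IntD2 bij_betw_def image_eqI vimageE)
    next
      fix y assume "y \<in> f ` A"
      then obtain x where "x \<in> A" "y = f x" by blast
      then show "y \<in> the_inv_into A0 f -` A \<inter> B0"
        using A(2) bij the_inv_into_f_f[of f A0 x] by (auto simp: bij_betw_def)
    qed
    finally obtain S N0 N' where S: "f ` A = S \<union> N0" "N0 \<subseteq> N'" "N' \<in> null_sets N" "S \<in> sets N"
      by (elim sets_completionE)
    have N': "N' \<in> sets (completion N)" "emeasure (completion N) N' = 0"
      using null_sets_completionI[OF S(3)] by (auto simp: null_sets_def)
    have "emeasure M (f -` N' \<inter> A0) = emeasure (restrict_space M A0) (f -` (N' \<inter> B0) \<inter> A0)"
      using A0(1) bij by (subst emeasure_restrict_space) (auto simp: bij_betw_def intro!: arg_cong2[where f = emeasure])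
    also have "\<dots> = emeasure (distr (restrict_space M A0) (restrict_space (completion N) B0) f) (N' \<inter> B0)"
      using N' B0 by (subst emeasure_distr[OF fm]) (auto simp: setsB spA)
    also have "\<dots> = emeasure (completion N) (N' \<inter> B0)"
      unfolding df using B0 by (subst emeasure_restrict_space) (auto simp: spN)
    also have "\<dots> = 0"
      using N' emeasure_mono[of "N' \<inter> B0" N' "completion N"] by simp
    finally have "f -` N' \<inter> A0 \<in> null_sets M"
      using f_vim[OF N'(1)] by auto
    moreover have "A - g -` S \<subseteq> f -` N' \<inter> A0"
    proof
      fix x assume x: "x \<in> A - g -` S"
      then have "f x \<in> S \<union> N0" using S(1) by auto
      with x S(2) A(2) show "x \<in> f -` N' \<inter> A0" by (auto simp: g_def split: if_splits)
    qed
    ultimately have "A - g -` S \<in> null_sets M"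
      by (rule complete2[rotated])
    then show ?thesis
      using S gf[OF A(2)] N by (intro bexI[of _ S]) auto
  qed
  moreover have "inj_on g A0"
    using bij by (auto simp: bij_betw_def g_def inj_on_def)
  ultimately show ?thesis
    using A0 gm by (intro that[of A0 g])
qed

text \<open>
  The set \<open>T\<close> in the proof is a Borel part of the graph of \<open>\<Psi>\<close> over the real coordinate \<open>g\<close>; a compact
  subset of it projects to a compact set of values of \<open>\<Psi>\<close>. This replaces Lusin's theorem.
\<close>
lemma standard_prob_space_inner_compact:
  fixes \<Psi> :: "'a \<Rightarrow> 'b::polish_space"
  assumes std: "standard_prob_space M" and \<Psi>: "\<Psi> \<in> borel_measurable M"
    and A: "A \<in> sets M" and e: "e > 0"
  shows "\<exists>K\<in>sets M. K \<subseteq> A \<and> measure M A < measure M K + e \<and> compact (\<Psi> ` K)"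
proof -
  interpret prob_space M using std by (simp add: standard_prob_space_def)
  interpret complete_measure M using std by (simp add: standard_prob_space_def)
  obtain A0 and g :: "'a \<Rightarrow> real" where A0: "A0 \<in> sets M" "space M - A0 \<in> null_sets M"
    and g: "g \<in> borel_measurable M" "inj_on g A0"
    and inner: "\<And>A. A \<in> sets M \<Longrightarrow> A \<subseteq> A0 \<Longrightarrow> \<exists>B\<in>sets borel. B \<subseteq> g ` A \<and> A - g -` B \<in> null_sets M"
    using standard_prob_space_real_coordinate[OF std] by metis
  define A1 where "A1 = A \<inter> A0"
  have A1: "A1 \<in> sets M" "A1 \<subseteq> A0" using A A0 by (auto simp: A1_def)
  obtain \<V> :: "'b set set" where \<V>: "countable \<V>" "topological_basis \<V>"
    using ex_countable_basis by blast
  have opV: "open V" if "V \<in> \<V>" for V using \<V>(2) that by (rule topological_basis_open)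
  have sepV: "\<exists>V\<in>\<V>. v \<in> V \<and> w \<notin> V" if "v \<noteq> w" for v w
  proof -
    obtain U where "open U" "v \<in> U" "w \<notin> U" using separation_t1[of v w] \<open>v \<noteq> w\<close> by metis
    then show ?thesis using topological_basisE[OF \<V>(2) \<open>open U\<close> \<open>v \<in> U\<close>] by blast
  qed
  have "\<Psi> -` V \<inter> A1 \<in> sets M" "A1 - \<Psi> -` V \<in> sets M" if "V \<in> \<V>" for V
  proof -
    have "\<Psi> -` V \<inter> space M \<in> sets M"
      using opV[OF that] \<Psi> by (intro measurable_sets[OF \<Psi>]) auto
    then have "(\<Psi> -` V \<inter> space M) \<inter> A1 \<in> sets M" "A1 - (\<Psi> -` V \<inter> space M) \<in> sets M"
      using A1 by auto
    moreover have "(\<Psi> -` V \<inter> space M) \<inter> A1 = \<Psi> -` V \<inter> A1" "A1 - (\<Psi> -` V \<inter> space M) = A1 - \<Psi> -` V"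
      using A1(1) sets.sets_into_space by auto
    ultimately show "\<Psi> -` V \<inter> A1 \<in> sets M" "A1 - \<Psi> -` V \<in> sets M" by simp_all
  qed
  note \<Psi>V = this
  have exP: "\<forall>V\<in>\<V>. \<exists>B. B \<in> sets borel \<and> B \<subseteq> g ` (\<Psi> -` V \<inter> A1) \<and> (\<Psi> -` V \<inter> A1) - g -` B \<in> null_sets M"
  proof
    fix V assume "V \<in> \<V>"
    from inner[OF \<Psi>V(1)[OF this]] A1(2) show "\<exists>B. B \<in> sets borel \<and> B \<subseteq> g ` (\<Psi> -` V \<inter> A1) \<and> (\<Psi> -` V \<inter> A1) - g -` B \<in> null_sets M"
      by blast
  qed
  have exQ: "\<forall>V\<in>\<V>. \<exists>B. B \<in> sets borel \<and> B \<subseteq> g ` (A1 - \<Psi> -` V) \<and> (A1 - \<Psi> -` V) - g -` B \<in> null_sets M"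
  proof
    fix V assume "V \<in> \<V>"
    from inner[OF \<Psi>V(2)[OF this]] A1(2) show "\<exists>B. B \<in> sets borel \<and> B \<subseteq> g ` (A1 - \<Psi> -` V) \<and> (A1 - \<Psi> -` V) - g -` B \<in> null_sets M"
      by blast
  qed
  from bchoice[OF exP] obtain P where
    P: "\<forall>V\<in>\<V>. P V \<in> sets borel \<and> P V \<subseteq> g ` (\<Psi> -` V \<inter> A1) \<and> (\<Psi> -` V \<inter> A1) - g -` P V \<in> null_sets M" ..
  from bchoice[OF exQ] obtain Q where
    Q: "\<forall>V\<in>\<V>. Q V \<in> sets borel \<and> Q V \<subseteq> g ` (A1 - \<Psi> -` V) \<and> (A1 - \<Psi> -` V) - g -` Q V \<in> null_sets M" ..
  have PQ:
    "\<And>V. V \<in> \<V> \<Longrightarrow> P V \<in> sets borel" "\<And>V. V \<in> \<V> \<Longrightarrow> Q V \<in> sets borel"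
    "\<And>V. V \<in> \<V> \<Longrightarrow> P V \<subseteq> g ` (\<Psi> -` V \<inter> A1)" "\<And>V. V \<in> \<V> \<Longrightarrow> Q V \<subseteq> g ` (A1 - \<Psi> -` V)"
    "\<And>V. V \<in> \<V> \<Longrightarrow> (\<Psi> -` V \<inter> A1) - g -` P V \<in> null_sets M"
    "\<And>V. V \<in> \<V> \<Longrightarrow> (A1 - \<Psi> -` V) - g -` Q V \<in> null_sets M"
    using P Q by simp_all
  obtain B1 where B1: "B1 \<in> sets borel" "B1 \<subseteq> g ` A1" "A1 - g -` B1 \<in> null_sets M"
    using inner[OF A1] by blast
  \<comment> \<open>\<open>P V\<close> and \<open>Q V\<close> are Borel parts of the
    \<open>g\<close>-images of the places in \<open>A1\<close> where \<Psi> lies inside or outside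
    \<open>V\<close>. If \<open>(y, v)\<close> is in \<open>T\<close> and \<open>y = g x\<close>
    with \<open>x\<close> in \<open>A1\<close>, then \<open>v\<close> and \<open>\<Psi> x\<close>
    lie in the same basic sets, so they are equal.\<close>
  define T where "T = (B1 \<times> UNIV) \<inter> (\<Inter>V\<in>\<V>. P V \<times> V \<union> Q V \<times> (- V))"
  have T: "T \<in> sets borel"
  proof -
    have "P V \<times> V \<union> Q V \<times> (- V) \<in> sets (borel \<Otimes>\<^sub>M borel)" if "V \<in> \<V>" for V
      using PQ(1,2)[OF that] opV[OF that] by (intro sets.Un pair_measureI borel_comp) auto
    then have "(B1 \<times> UNIV) \<inter> (\<Inter>V\<in>\<V>. P V \<times> V \<union> Q V \<times> (- V)) \<in> sets (borel \<Otimes>\<^sub>M borel)"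
      if "\<V> \<noteq> {}"
      using \<V>(1) B1(1) that by (intro sets.Int pair_measureI sets.countable_INT') auto
    moreover have "B1 \<times> (UNIV :: 'b set) \<in> sets (borel \<Otimes>\<^sub>M borel)"
      using B1(1) by (intro pair_measureI) auto
    ultimately have "T \<in> sets (borel \<Otimes>\<^sub>M borel)"
      unfolding T_def by (cases "\<V> = {}") auto
    then show ?thesis
      unfolding borel_prod .
  qed
  define \<Gamma> where "\<Gamma> x = (g x, \<Psi> x)" for x
  have \<Gamma>: "\<Gamma> \<in> borel_measurable M"
    unfolding \<Gamma>_def using g(1) \<Psi> by (rule borel_measurable_Pair)
  have T_sub: "\<exists>x\<in>A1. p = \<Gamma> x" if pT: "p \<in> T" for p
  proof -
    obtain y v where p: "p = (y, v)" by (cases p)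
    then obtain x where x: "x \<in> A1" "y = g x" using pT B1(2) by (auto simp: T_def)
    have "\<Psi> x = v"
    proof (rule ccontr)
      assume "\<Psi> x \<noteq> v"
      then obtain V where V: "V \<in> \<V>" "v \<in> V" "\<Psi> x \<notin> V" using sepV[of v "\<Psi> x"] by blast
      then have "y \<in> P V" using pT p by (auto simp: T_def)
      then obtain x' where "x' \<in> A1" "\<Psi> x' \<in> V" "g x' = g x" using PQ(3)[OF V(1)] x by auto
      then show False using g(2) x A1(2) V by (auto dest: inj_onD)
    qed
    then show ?thesis using x p by (auto simp: \<Gamma>_def)
  qed
  have "A1 - \<Gamma> -` T \<subseteq> (A1 - g -` B1) \<union> (\<Union>V\<in>\<V>. ((\<Psi> -` V \<inter> A1) - g -` P V) \<union> ((A1 - \<Psi> -` V) - g -` Q V))"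
    by (auto simp: T_def \<Gamma>_def)
  moreover have "\<dots> \<in> null_sets M"
    using \<V>(1) PQ(5,6) B1(3) by (intro null_sets.Un null_sets_UN') auto
  ultimately have nullT: "A1 - \<Gamma> -` T \<in> null_sets M" by (rule complete2)
  let ?\<nu> = "distr M borel \<Gamma>"
  interpret \<nu>: prob_space ?\<nu> using \<Gamma> by (rule prob_space_distr)
  have meas_vim: "\<Gamma> -` C \<inter> space M \<in> sets M" if "C \<in> sets borel" for C
    using that by (rule measurable_sets[OF \<Gamma>])
  have meas_eq: "measure M (\<Gamma> -` C \<inter> space M) = measure M (\<Gamma> -` C \<inter> A1)" if "C \<in> sets borel" "C \<subseteq> T" for C
  proof (rule measure_eq_AE)
    have "\<Gamma> -` C \<inter> A1 = (\<Gamma> -` C \<inter> space M) \<inter> A1"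
      using A1(1) sets.sets_into_space by auto
    then show "\<Gamma> -` C \<inter> A1 \<in> sets M" using meas_vim[OF that(1)] A1 by auto
    \<comment> \<open>Off the null complement of \<open>A0\<close>, injectivity of \<open>g\<close>
      forces every point with value in \<open>C\<close> into \<open>A1\<close>.\<close>
    have xA1: "x \<in> A1" if xC: "\<Gamma> x \<in> C" "x \<in> A0" for x
    proof -
      obtain x' where "x' \<in> A1" "\<Gamma> x = \<Gamma> x'" using T_sub \<open>C \<subseteq> T\<close> xC(1) by blast
      then show ?thesis using g(2) A1(2) xC(2) by (auto simp: \<Gamma>_def dest: inj_onD)
    qed
    have "AE x in M. x \<in> A0"
      using AE_not_in[OF A0(2)] AE_space by eventually_elim auto
    then show "AE x in M. x \<in> \<Gamma> -` C \<inter> space M \<longleftrightarrow> x \<in> \<Gamma> -` C \<inter> A1"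
    proof eventually_elim
      case (elim x)
      then show ?case
        using xA1[of x] sets.sets_into_space[OF A1(1)] by auto
    qed
  qed (rule meas_vim[OF that(1)])
  have reg: "emeasure ?\<nu> T = (SUP K\<in>{K. K \<subseteq> T \<and> compact K}. emeasure ?\<nu> K)"
    by (rule inner_regular) (use T in \<open>auto simp: \<nu>.emeasure_eq_measure\<close>)
  have "\<exists>C. C \<subseteq> T \<and> compact C \<and> measure ?\<nu> T < measure ?\<nu> C + e"
  proof (rule ccontr)
    assume "\<not> ?thesis"
    then have neg: "measure ?\<nu> C \<le> measure ?\<nu> T - e" if "C \<subseteq> T" "compact C" for C
      using that by (force simp: not_less)
    then have "(SUP K\<in>{K. K \<subseteq> T \<and> compact K}. emeasure ?\<nu> K) \<le> ennreal (measure ?\<nu> T - e)"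
      by (intro SUP_least) (auto simp: \<nu>.emeasure_eq_measure intro!: ennreal_leI)
    then have "ennreal (measure ?\<nu> T) \<le> ennreal (measure ?\<nu> T - e)"
      using reg by (simp add: \<nu>.emeasure_eq_measure)
    \<comment> \<open>The empty set is a compact competitor. Nonnegativity matters because
      \<open>ennreal\<close> truncates negative numbers to 0.\<close>
    moreover have "0 \<le> measure ?\<nu> T - e"
      using neg[of "{}"] by simp
    ultimately show False using e by (simp add: ennreal_le_iff)
  qed
  then obtain C where C: "C \<subseteq> T" "compact C" "measure ?\<nu> T < measure ?\<nu> C + e" by blast
  have Cb: "C \<in> sets borel" using C(2) by (simp add: compact_imp_closed borel_closed)
  define K where "K = \<Gamma> -` C \<inter> A1"
  have "K = (\<Gamma> -` C \<inter> space M) \<inter> A1"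
    using A1(1) sets.sets_into_space by (auto simp: K_def)
  then have K: "K \<in> sets M" using meas_vim[OF Cb] A1 by auto
  have "measure M A = measure M A1"
  proof (rule measure_eq_AE[OF _ A A1(1)])
    show "AE x in M. x \<in> A \<longleftrightarrow> x \<in> A1"
      using AE_not_in[OF A0(2)] AE_space by eventually_elim (auto simp: A1_def)
  qed
  also have "\<dots> = measure M (\<Gamma> -` T \<inter> A1)"
  proof (rule measure_eq_AE[OF _ A1(1)])
    show "AE x in M. x \<in> A1 \<longleftrightarrow> x \<in> \<Gamma> -` T \<inter> A1"
      using AE_not_in[OF nullT] by eventually_elim auto
    have "\<Gamma> -` T \<inter> A1 = (\<Gamma> -` T \<inter> space M) \<inter> A1"
      using A1(1) sets.sets_into_space by auto
    then show "\<Gamma> -` T \<inter> A1 \<in> sets M" using meas_vim[OF T] A1 by auto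
  qed
  also have "\<dots> = measure ?\<nu> T"
    using meas_eq[OF T] by (simp add: measure_distr[OF \<Gamma>] T)
  also have "\<dots> < measure ?\<nu> C + e" by (rule C)
  also have "measure ?\<nu> C = measure M K"
    using meas_eq[OF Cb C(1)] Cb by (simp add: measure_distr[OF \<Gamma>] K_def)
  finally have "measure M A < measure M K + e" .
  moreover have "\<Psi> ` K = snd ` C"
  proof safe
    fix x assume "x \<in> K" then show "\<Psi> x \<in> snd ` C" by (force simp: K_def \<Gamma>_def)
  next
    fix y v assume "(y, v) \<in> C"
    then obtain x where "x \<in> A1" "(y, v) = \<Gamma> x" using C(1) T_sub by blast
    then show "snd (y, v) \<in> \<Psi> ` K" using \<open>(y, v) \<in> C\<close> by (auto simp: K_def \<Gamma>_def)
  qed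
  moreover have "compact (snd ` C)"
    by (rule compact_continuous_image[OF _ C(2)]) (intro continuous_intros)
  ultimately show ?thesis
    using K by (intro bexI[of _ K]) (auto simp: K_def A1_def)
qed

text \<open>The image of \<open>A\<close> need not be Borel, but a countable union of compact images
  with errors \<open>1 / Suc n\<close> is, and no mass is lost. It is through this set that the
  isomorphism with the line enters all later arguments.\<close>

lemma standard_prob_space_inner_borel:
  fixes f :: "'a \<Rightarrow> 'c::polish_space"
  assumes std: "standard_prob_space M" and f: "f \<in> borel_measurable M" and A: "A \<in> sets M"
  shows "\<exists>S\<in>sets borel. S \<subseteq> f ` A \<and> measure M A \<le> measure (distr M borel f) S"
proof -
  interpret prob_space M using std by (simp add: standard_prob_space_def)
  have "\<forall>n. \<exists>K. K \<in> sets M \<and> K \<subseteq> A \<and> measure M A < measure M K + 1 / real (Suc n) \<and> compact (f ` K)"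
    using standard_prob_space_inner_compact[OF std f A] by (metis divide_pos_pos of_nat_0_less_iff zero_less_Suc zero_less_one)
  from choice[OF this] obtain K where
    K: "\<And>n. K n \<in> sets M" "\<And>n. K n \<subseteq> A" "\<And>n. measure M A < measure M (K n) + 1 / real (Suc n)"
      "\<And>n. compact (f ` K n)" by blast
  define S where "S = (\<Union>n. f ` K n)"
  have S: "S \<in> sets borel"
    unfolding S_def using K(4) by (intro sets.countable_UN) (auto intro: borel_closed compact_imp_closed)
  have le: "measure M A \<le> measure (distr M borel f) S + 1 / real (Suc n)" for n
  proof -
    have "measure M (K n) \<le> measure M (f -` S \<inter> space M)"
      using K(1)[of n] sets.sets_into_space[OF K(1)[of n]] measurable_sets[OF f S]
      by (intro finite_measure_mono) (auto simp: S_def)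
    then show ?thesis
      using K(3)[of n] by (simp add: measure_distr[OF f S])
  qed
  have "measure M A \<le> measure (distr M borel f) S + e" if e: "e > 0" for e
  proof -
    obtain n where "1 / real (Suc n) < e"
      using nat_approx_posE[OF e] by blast
    then show ?thesis using le[of n] by linarith
  qed
  then have "measure M A \<le> measure (distr M borel f) S"
    by (rule field_le_epsilon)
  then show ?thesis
    using S K(2) by (intro bexI[of _ S]) (auto simp: S_def)
qed

text \<open>The common distribution gives full mass to a Borel set inside the image of
  \<open>N\<close> and positive mass to one inside the image of \<open>U\<close>; if they were
  disjoint, the total would exceed 1.\<close>

lemma standard_prob_spaces_common_value:
  fixes f :: "'a \<Rightarrow> 'c::polish_space" and g :: "'b \<Rightarrow> 'c"
  assumes M: "standard_prob_space M" and N: "standard_prob_space N"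
    and f: "f \<in> borel_measurable M" and g: "g \<in> borel_measurable N"
    and eq: "distr M borel f = distr N borel g"
    and U: "U \<in> sets M" "emeasure M U > 0"
  shows "\<exists>x\<in>U. \<exists>y\<in>space N. f x = g y"
proof (rule ccontr)
  assume contra: "\<not> ?thesis"
  interpret M: prob_space M using M by (simp add: standard_prob_space_def)
  interpret N: prob_space N using N by (simp add: standard_prob_space_def)
  interpret D: prob_space "distr M borel f" using f by (rule M.prob_space_distr)
  obtain S where S: "S \<in> sets borel" "S \<subseteq> f ` U" "measure M U \<le> measure (distr M borel f) S"
    using standard_prob_space_inner_borel[OF M f U(1)] by blast
  obtain T where T: "T \<in> sets borel" "T \<subseteq> g ` space N" "measure N (space N) \<le> measure (distr N borel g) T"
    using standard_prob_space_inner_borel[OF N g sets.top] by blast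
  have "S \<inter> T = {}" using contra S(2) T(2) by blast
  then have "measure (distr M borel f) (S \<union> T) = measure (distr M borel f) S + measure (distr M borel f) T"
    using S(1) T(1) by (intro D.finite_measure_Union) auto
  moreover have "measure M U > 0" using U(2) by (simp add: M.emeasure_eq_measure)
  ultimately show False
    using S(3) T(3) D.prob_le_1[of "S \<union> T"] by (simp add: eq N.prob_space)
qed

text \<open>A measurable \<open>B\<close> need not be the \<open>g\<close>-preimage of a Borel set,
  so measurability of \<open>f\<close> does not simply pass to \<phi>. Instead the preimage of
  \<open>B\<close> is sandwiched between two sets defined through \<open>f\<close>, one from a Borel
  set inside the image of \<open>B\<close>, the other from one inside the image of its complement.
  Their measures agree, and completeness of \<open>M\<close> finishes.\<close>

lemma measure_preserving_of_equal_distr: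
  fixes f :: "'a \<Rightarrow> 'c::polish_space" and g :: "'b \<Rightarrow> 'c"
  assumes M: "standard_prob_space M" and N: "standard_prob_space N"
    and f: "f \<in> borel_measurable M" and g: "g \<in> borel_measurable N"
    and eq: "distr M borel f = distr N borel g"
    and inj: "inj_on g (space N)"
    and \<phi>: "\<And>x. x \<in> space M \<Longrightarrow> \<phi> x \<in> space N" "\<And>x. x \<in> space M \<Longrightarrow> g (\<phi> x) = f x"
  shows "\<phi> \<in> measurable M N" "distr M N \<phi> = N"
proof -
  interpret M: prob_space M using M by (simp add: standard_prob_space_def)
  interpret cM: complete_measure M using M by (simp add: standard_prob_space_def)
  interpret N: prob_space N using N by (simp add: standard_prob_space_def)
  interpret D: prob_space "distr M borel f" using f by (rule M.prob_space_distr)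
  have main: "\<phi> -` B \<inter> space M \<in> sets M \<and> measure M (\<phi> -` B \<inter> space M) = measure N B"
    if B: "B \<in> sets N" for B
  proof -
    obtain S where S: "S \<in> sets borel" "S \<subseteq> g ` B" "measure N B \<le> measure (distr N borel g) S"
      using standard_prob_space_inner_borel[OF N g B] by blast
    obtain T where T: "T \<in> sets borel" "T \<subseteq> g ` (space N - B)"
        "measure N (space N - B) \<le> measure (distr N borel g) T"
      using standard_prob_space_inner_borel[OF N g sets.compl_sets[OF B]] by blast
    define A where "A = f -` S \<inter> space M"
    define C where "C = space M - (f -` T \<inter> space M)"
    have A: "A \<in> sets M" and C: "C \<in> sets M"
      unfolding A_def C_def using measurable_sets[OF f S(1)] measurable_sets[OF f T(1)] by auto
    have sub1: "A \<subseteq> \<phi> -` B \<inter> space M"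
    proof
      fix x assume x: "x \<in> A"
      then obtain y where y: "y \<in> B" "f x = g y" using S(2) by (auto simp: A_def)
      then have "\<phi> x = y"
        using x \<phi> inj sets.sets_into_space[OF B] by (auto simp: A_def inj_on_def)
      then show "x \<in> \<phi> -` B \<inter> space M" using y x by (auto simp: A_def)
    qed
    have sub2: "\<phi> -` B \<inter> space M \<subseteq> C"
    proof
      fix x assume x: "x \<in> \<phi> -` B \<inter> space M"
      have "f x \<notin> T"
      proof
        assume "f x \<in> T"
        then obtain y where y: "y \<in> space N - B" "f x = g y" using T(2) by auto
        then have "\<phi> x = y"
          using x \<phi> inj by (auto simp: inj_on_def)
        then show False using x y by auto
      qed
      then show "x \<in> C" using x by (auto simp: C_def)
    qed
    have mA: "measure M A \<ge> measure N B"
      using S by (simp add: A_def eq[symmetric] measure_distr[OF f S(1)])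
    have "measure M C = 1 - measure (distr M borel f) T"
      unfolding C_def using measurable_sets[OF f T(1)]
      by (subst M.prob_compl) (auto simp: measure_distr[OF f T(1)])
    then have mC: "measure M C \<le> measure N B"
      using T(3) N.prob_compl[OF B] by (simp add: eq)
    have "measure M A \<le> measure M C"
      using sub1 sub2 by (intro M.finite_measure_mono C) auto
    with mA mC have "measure M A = measure M C" by linarith
    then have in_sets: "\<phi> -` B \<inter> space M \<in> sets M"
      by (intro cM.complete_sets_sandwich[OF A C sub1 sub2]) (auto simp: M.emeasure_eq_measure)
    moreover have "measure M A \<le> measure M (\<phi> -` B \<inter> space M)" "measure M (\<phi> -` B \<inter> space M) \<le> measure M C"
      using sub1 sub2 in_sets C by (auto intro!: M.finite_measure_mono)
    ultimately show ?thesis using mA mC by auto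
  qed
  show meas: "\<phi> \<in> measurable M N"
    using main \<phi>(1) by (auto intro!: measurableI)
  show "distr M N \<phi> = N"
    by (rule measure_eqI)
       (use main in \<open>auto simp: emeasure_distr[OF meas] M.emeasure_eq_measure N.emeasure_eq_measure\<close>)
qed

lemma measure_preserving_bij_of_equal_distr:
  fixes f :: "'a \<Rightarrow> 'c::polish_space" and g :: "'b \<Rightarrow> 'c"
  assumes M: "standard_prob_space M" and N: "standard_prob_space N"
    and f: "f \<in> borel_measurable M" and g: "g \<in> borel_measurable N"
    and eq: "distr M borel f = distr N borel g"
    and inj: "inj_on f (space M)" "inj_on g (space N)"
    and \<phi>: "bij_betw \<phi> (space M) (space N)" "\<And>x. x \<in> space M \<Longrightarrow> g (\<phi> x) = f x"
  shows "measure_preserving_bij M N \<phi>"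
proof -
  have inv: "the_inv_into (space M) \<phi> y \<in> space M" "\<phi> (the_inv_into (space M) \<phi> y) = y"
    if "y \<in> space N" for y
    using \<phi>(1) that bij_betw_the_inv_into[OF \<phi>(1)] f_the_inv_into_f_bij_betw[OF \<phi>(1)]
    by (auto simp: bij_betw_def)
  have "the_inv_into (space M) \<phi> \<in> measurable N M"
    using inv \<phi>(2) by (intro measure_preserving_of_equal_distr(1)[OF N M g f eq[symmetric] inj(1)]) metis+
  moreover have "\<phi> \<in> measurable M N" "distr M N \<phi> = N"
    using \<phi> by (auto intro!: measure_preserving_of_equal_distr[OF M N f g eq inj(2)] simp: bij_betw_def)
  ultimately show ?thesis
    using \<phi>(1) by (simp add: measure_preserving_bij_def)
qed

lemma AE_eq_of_density_distr_eq:
  fixes f :: "'a \<Rightarrow> 'c::polish_space" and u v :: "'a \<Rightarrow> real"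
  assumes M: "standard_prob_space M" and f: "f \<in> borel_measurable M" and inj: "inj_on f (space M)"
    and u: "u \<in> borel_measurable M" "\<And>x. x \<in> space M \<Longrightarrow> u x \<in> {0..1}"
    and v: "v \<in> borel_measurable M" "\<And>x. x \<in> space M \<Longrightarrow> v x \<in> {0..1}"
    and eq: "distr (density M u) borel f = distr (density M v) borel f"
  shows "AE x in M. u x = v x"
proof -
  interpret prob_space M using M by (simp add: standard_prob_space_def)
  have "density M u = density M v"
  proof (rule measure_eqI)
    fix A assume "A \<in> sets (density M u)"
    then have A: "A \<in> sets M" by simp
    obtain S where S: "S \<in> sets borel" "S \<subseteq> f ` A" "measure M A \<le> measure (distr M borel f) S"
      using standard_prob_space_inner_borel[OF M f A] by blast
    define A' where "A' = f -` S \<inter> space M"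
    have A': "A' \<in> sets M" unfolding A'_def by (rule measurable_sets[OF f S(1)])
    have "A' \<subseteq> A"
    proof
      fix x assume x: "x \<in> A'"
      then obtain y where "y \<in> A" "f x = f y" using S(2) by (auto simp: A'_def)
      then show "x \<in> A"
        using x inj sets.sets_into_space[OF A] by (auto simp: A'_def inj_on_def)
    qed
    moreover have "measure M A \<le> measure M A'"
      using S by (simp add: measure_distr[OF f S(1)] A'_def)
    ultimately have "measure M (A - A') = 0"
      using finite_measure_Diff[OF A A'] finite_measure_mono[OF _ A, of A'] by simp
    then have null: "A - A' \<in> null_sets M"
      using A A' by (auto simp: emeasure_eq_measure)
    have AE: "AE x in M. x \<in> A \<longleftrightarrow> x \<in> A'"
      using AE_not_in[OF null] by eventually_elim (use \<open>A' \<subseteq> A\<close> in auto)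
    have *: "emeasure (density M w) A = emeasure (distr (density M w) borel f) S" if "w \<in> borel_measurable M" for w :: "'a \<Rightarrow> real"
    proof -
      have "emeasure (distr (density M w) borel f) S = emeasure (density M w) A'"
        using S(1) f by (subst emeasure_distr) (auto simp: A'_def)
      moreover have "emeasure (density M w) A = emeasure (density M w) A'"
      proof (rule emeasure_eq_AE)
        show "AE x in density M w. x \<in> A \<longleftrightarrow> x \<in> A'"
          using AE that by (subst AE_density) auto
      qed (use A A' in auto)
      ultimately show ?thesis by simp
    qed
    show "emeasure (density M u) A = emeasure (density M v) A"
      using *[OF u(1)] *[OF v(1)] eq by simp
  qed simp
  then have "AE x in M. ennreal (u x) = ennreal (v x)"
    using u(1) v(1) by (intro density_unique) auto
  then show ?thesis
    using AE_space by eventually_elim (use u(2) v(2) in \<open>auto simp: ennreal_inj\<close>)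
qed

section \<open>Pure graphons and codegrees\<close>

sublocale graphon \<subseteq> prob_space M
  using standard by (simp add: standard_prob_space_def)

lemma (in finite_measure) finite_disjoint_large:
  assumes "disjoint_family_on A S" "\<And>s. s \<in> S \<Longrightarrow> A s \<in> sets M" "c > 0"
    "\<And>s. s \<in> S \<Longrightarrow> c \<le> measure M (A s)"
  shows "finite S"
proof -
  have "card F \<le> nat \<lceil>measure M (space M) / c\<rceil>" if F: "F \<subseteq> S" "finite F" for F
  proof -
    have "real (card F) * c = (\<Sum>s\<in>F. c)" by simp
    also have "\<dots> \<le> (\<Sum>s\<in>F. measure M (A s))"
      using F assms(4) by (intro sum_mono) auto
    also have "\<dots> = measure M (\<Union>s\<in>F. A s)"
      using F assms(1,2) by (intro finite_measure_finite_Union[symmetric]) (auto simp: disjoint_family_on_def)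
    also have "\<dots> \<le> measure M (space M)"
      by (rule bounded_measure)
    finally have "real (card F) \<le> measure M (space M) / c"
      using assms(3) by (simp add: le_divide_eq)
    then show ?thesis by linarith
  qed
  then show ?thesis
    using finite_if_finite_subsets_card_bdd by blast
qed

section \<open>Separability, measurable versions and codegrees of a pure graphon\<close>

context pure_graphon
begin

abbreviation "r \<equiv> graphon_dist M W"

text \<open>A set outside \<open>sets M\<close> has \<open>emeasure\<close> 0 by convention, so full
  support already forces nonempty open sets to be measurable.\<close>

lemma sets_open: "openin mtopology U \<Longrightarrow> U \<in> sets M"
  using full_support[of U] emeasure_notin_sets[of U M] by (cases "U = {}") auto

lemma measure_ball_pos: "x \<in> space M \<Longrightarrow> e > 0 \<Longrightarrow> emeasure M (mball x e) > 0"
  by (rule full_support) auto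

text \<open>A maximal set of points at mutual distance at least \<open>e\<close> is a net. The balls
  of radius \<open>e/2\<close> around its points are disjoint and of positive measure, so a
  probability space has room for countably many only. Full support thus yields separability.\<close>

lemma countable_net:
  assumes e: "e > 0"
  shows "\<exists>S. countable S \<and> S \<subseteq> space M \<and> (\<forall>x\<in>space M. \<exists>s\<in>S. r x s < e)"
proof -
  define \<A> where "\<A> = {S. S \<subseteq> space M \<and> (\<forall>x\<in>S. \<forall>y\<in>S. x \<noteq> y \<longrightarrow> e \<le> r x y)}"
  have "\<exists>S\<in>\<A>. \<forall>X\<in>\<A>. S \<subseteq> X \<longrightarrow> X = S"
  proof (rule subset_Zorn_nonempty)
    show "\<A> \<noteq> {}" by (auto simp: \<A>_def)
    fix \<C> assume "\<C> \<noteq> {}" and chain: "subset.chain \<A> \<C>"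
    from chain have sub: "\<C> \<subseteq> \<A>" and lin: "\<And>A B. A \<in> \<C> \<Longrightarrow> B \<in> \<C> \<Longrightarrow> A \<subseteq> B \<or> B \<subseteq> A"
      by (auto simp: subset.chain_def)
    have "e \<le> r x y" if xy: "x \<in> A" "A \<in> \<C>" "y \<in> B" "B \<in> \<C>" "x \<noteq> y" for x y A B
    proof -
      from lin[OF xy(2,4)] obtain C where "C \<in> \<A>" "x \<in> C" "y \<in> C"
        using sub xy by (metis subsetD)
      with xy(5) show ?thesis by (simp add: \<A>_def)
    qed
    moreover have "\<Union>\<C> \<subseteq> space M"
      using sub by (auto simp: \<A>_def)
    ultimately show "\<Union>\<C> \<in> \<A>"
      unfolding \<A>_def by simp
  qed
  then obtain S where S: "S \<in> \<A>" and maxS: "\<And>X. X \<in> \<A> \<Longrightarrow> S \<subseteq> X \<Longrightarrow> X = S" by blast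
  have Ssub: "S \<subseteq> space M" and sep: "\<And>x y. x \<in> S \<Longrightarrow> y \<in> S \<Longrightarrow> x \<noteq> y \<Longrightarrow> e \<le> r x y"
    using S by (auto simp: \<A>_def)
  have "\<exists>s\<in>S. r x s < e" if x: "x \<in> space M" for x
  proof (rule ccontr)
    assume "\<not> ?thesis"
    then have far: "\<And>s. s \<in> S \<Longrightarrow> e \<le> r x s" by (simp add: not_less)
    moreover have "\<And>s. s \<in> S \<Longrightarrow> e \<le> r s x" using far commute by metis
    ultimately have "insert x S \<in> \<A>"
      using S x unfolding \<A>_def by auto
    with maxS have "x \<in> S" by blast
    with far[of x] x e show False using zero[of x x] by auto
  qed
  moreover have "countable S"
  proof -
    define T where "T n = {s \<in> S. 1 / real (Suc n) \<le> measure M (mball s (e/2))}" for n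
    have "disjoint_family_on (\<lambda>s. mball s (e/2)) S"
      unfolding disjoint_family_on_def
    proof (intro ballI impI)
      fix s t assume st: "s \<in> S" "t \<in> S" "s \<noteq> t"
      show "mball s (e/2) \<inter> mball t (e/2) = {}"
      proof (rule ccontr)
        assume "mball s (e/2) \<inter> mball t (e/2) \<noteq> {}"
        then obtain z where "z \<in> space M" "s \<in> space M" "t \<in> space M" "r s z < e/2" "r t z < e/2" by auto
        then have "r s t < e" using triangle[of s z t] commute[of t z] by simp
        then show False using sep[OF st] by simp
      qed
    qed
    then have "finite (T n)" for n
      by (intro finite_disjoint_large[of "\<lambda>s. mball s (e/2)" _ "1 / real (Suc n)"])
         (auto simp: T_def sets_open disjoint_family_on_def)
    moreover have "S \<subseteq> (\<Union>n. T n)"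
    proof
      fix s assume s: "s \<in> S"
      then have "measure M (mball s (e/2)) > 0"
        using measure_ball_pos[of s "e/2"] Ssub e by (auto simp: emeasure_eq_measure)
      then obtain n where "1 / real (Suc n) < measure M (mball s (e/2))"
        using nat_approx_posE by blast
      then show "s \<in> (\<Union>n. T n)" using s by (auto simp: T_def intro!: exI[of _ n])
    qed
    ultimately show ?thesis
      by (meson countable_UN countable_finite countable_subset countableI_type)
  qed
  ultimately show ?thesis using Ssub by blast
qed

lemma dense_sequence:
  "\<exists>d :: nat \<Rightarrow> 'a. range d \<subseteq> space M \<and> (\<forall>x\<in>space M. \<forall>e>0. \<exists>n. r x (d n) < e)"
proof -
  have "\<forall>n. \<exists>S. countable S \<and> S \<subseteq> space M \<and> (\<forall>x\<in>space M. \<exists>s\<in>S. r x s < 1 / real (Suc n))"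
    using countable_net by simp
  from choice[OF this] obtain S where S: "\<And>n. countable (S n)" "\<And>n. S n \<subseteq> space M"
    "\<And>n x. x \<in> space M \<Longrightarrow> \<exists>s\<in>S n. r x s < 1 / real (Suc n)" by metis
  define D where "D = (\<Union>n. S n)"
  obtain x0 where "x0 \<in> space M" using not_empty by blast
  with S(3)[of x0 0] have "D \<noteq> {}" by (auto simp: D_def)
  have "countable D" using S(1) by (auto simp: D_def)
  have "from_nat_into D n \<in> space M" for n
    using from_nat_into[OF \<open>D \<noteq> {}\<close>] S(2) by (auto simp: D_def)
  moreover have "\<exists>n. r x (from_nat_into D n) < e" if x: "x \<in> space M" and e: "e > 0" for x e
  proof -
    obtain n where n: "1 / real (Suc n) < e" using nat_approx_posE[OF e] by blast
    obtain s where s: "s \<in> S n" "r x s < 1 / real (Suc n)" using S(3)[OF x] by blast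
    then have "s \<in> D" by (auto simp: D_def)
    then obtain m where "from_nat_into D m = s"
      using from_nat_into_surj[OF \<open>countable D\<close>] by blast
    then show ?thesis
      using n s by (intro exI[of _ m]) simp
  qed
  ultimately show ?thesis by (intro exI[of _ "from_nat_into D"]) auto
qed

lemma integrable_section: "x \<in> space M \<Longrightarrow> integrable M (W x)"
  using measurable_section range_W by (rule integrable_unit_interval)

lemma integrable_section_diff: "x \<in> space M \<Longrightarrow> y \<in> space M \<Longrightarrow> integrable M (\<lambda>z. \<bar>W x z - W y z\<bar>)"
  using integrable_section by auto

text \<open>Distances below a geometric series, not merely tending to 0, make the sum of all
  differences integrable, hence finite almost everywhere. The whole sequence converges and no
  subsequence depending on \<open>x\<close> has to be chosen.\<close>

lemma AE_sections_converge:
  assumes x: "x \<in> space M" and y: "\<And>n. y n \<in> space M" "\<And>n. r x (y n) < (1/2) ^ n"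
  shows "AE z in M. (\<lambda>n. W (y n) z) \<longlonglongrightarrow> W x z"
proof -
  have meas: "(\<lambda>z. \<bar>W x z - W (y n) z\<bar>) \<in> borel_measurable M" for n
    using measurable_section[OF x] measurable_section[OF y(1)] by auto
  have "(\<integral>\<^sup>+z. (\<Sum>n. ennreal \<bar>W x z - W (y n) z\<bar>) \<partial>M) = (\<Sum>n. \<integral>\<^sup>+z. ennreal \<bar>W x z - W (y n) z\<bar> \<partial>M)"
    using meas by (intro nn_integral_suminf) auto
  also have "\<dots> = (\<Sum>n. ennreal (r x (y n)))"
    unfolding graphon_dist_def
    by (intro suminf_cong nn_integral_eq_integral integrable_section_diff x y) auto
  also have "\<dots> \<le> (\<Sum>n. ennreal ((1/2) ^ n))"
    using y(2) by (intro suminf_le) (auto intro!: ennreal_leI less_imp_le)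
  also have "\<dots> = ennreal (\<Sum>n. (1/2) ^ n)"
    by (intro suminf_ennreal2) (auto intro: summable_geometric)
  also have "\<dots> < \<infinity>" by simp
  finally have "(\<integral>\<^sup>+z. (\<Sum>n. ennreal \<bar>W x z - W (y n) z\<bar>) \<partial>M) \<noteq> \<infinity>" by simp
  then have "AE z in M. (\<Sum>n. ennreal \<bar>W x z - W (y n) z\<bar>) \<noteq> \<infinity>"
    using meas by (intro nn_integral_PInf_AE) auto
  then show ?thesis
  proof eventually_elim
    case (elim z)
    then have "summable (\<lambda>n. \<bar>W x z - W (y n) z\<bar>)"
      by (intro summable_suminf_not_top) auto
    then have "(\<lambda>n. W x z - W (y n) z) \<longlonglongrightarrow> 0"
      using summable_LIMSEQ_zero tendsto_rabs_zero_iff by blast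
    from tendsto_diff[OF tendsto_const[of "W x z"] this] show ?case by simp
  qed
qed

text \<open>
  \<open>W\<close> is only measurable for the completed product. Replacing \<open>x\<close> by nearby points of a dense
  sequence gives jointly measurable approximations whose limit is correct on every section,
  not only on almost every one; this matters because the roots are fixed points.
\<close>
lemma measurable_version:
  obtains V :: "'a \<Rightarrow> 'a \<Rightarrow> real" where "(\<lambda>(x, y). V x y) \<in> borel_measurable (M \<Otimes>\<^sub>M M)"
    "\<And>x y. V x y \<in> {0..1}" "\<And>x. x \<in> space M \<Longrightarrow> AE y in M. V x y = W x y"
proof -
  obtain d :: "nat \<Rightarrow> 'a" where "range d \<subseteq> space M" "\<forall>x\<in>space M. \<forall>e>0. \<exists>n. r x (d n) < e"
    using dense_sequence by blast
  then have d: "\<And>n. d n \<in> space M" "\<And>x e. x \<in> space M \<Longrightarrow> e > 0 \<Longrightarrow> \<exists>n. r x (d n) < e"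
    by auto
  \<comment> \<open>\<open>s n\<close> takes countably many values and every \<open>W (d m)\<close>
    is measurable, which yields joint measurability. The radii are those of
    \<open>AE_sections_converge\<close>.\<close>
  define s where "s n x = (LEAST m. x \<in> mball (d m) ((1/2) ^ n))" for n :: nat and x
  \<comment> \<open>Clipping bounds \<open>V\<close> even where the limit fails to exist and
    \<open>lim\<close> is unspecified.\<close>
  define V where "V x y = max 0 (min 1 (lim (\<lambda>n. W (d (s n x)) y)))" for x y
  have s_meas: "s n \<in> measurable M (count_space UNIV)" for n
    unfolding s_def
  proof (rule measurable_Least)
    show "(\<lambda>x. x \<in> mball (d i) ((1 / 2) ^ n)) \<in> measurable M (count_space UNIV)" for i
      using sets_open[OF openin_mball] by (intro pred_sets2[where N = M]) auto
  qed
  have s: "r x (d (s n x)) < (1/2) ^ n" if x: "x \<in> space M" for x n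
  proof -
    obtain m where "r x (d m) < (1/2) ^ n" using d(2)[OF x, of "(1/2) ^ n"] by auto
    then have "x \<in> mball (d m) ((1/2) ^ n)" using x d(1) commute by auto
    then have "x \<in> mball (d (s n x)) ((1/2) ^ n)" unfolding s_def by (rule LeastI)
    then show ?thesis using commute by auto
  qed
  have "(\<lambda>p. W (d (s n (fst p))) (snd p)) \<in> borel_measurable (M \<Otimes>\<^sub>M M)" for n
  proof (rule measurable_compose_countable[where f = "\<lambda>m p. W (d m) (snd p)"])
    show "(\<lambda>p. W (d i) (snd p)) \<in> borel_measurable (M \<Otimes>\<^sub>M M)" for i
      using measurable_compose[OF measurable_snd measurable_section[OF d(1)]] .
    show "(\<lambda>p. s n (fst p)) \<in> measurable (M \<Otimes>\<^sub>M M) (count_space UNIV)"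
      using measurable_compose[OF measurable_fst s_meas] .
  qed
  then have "(\<lambda>p. lim (\<lambda>n. W (d (s n (fst p))) (snd p))) \<in> borel_measurable (M \<Otimes>\<^sub>M M)"
    by (rule borel_measurable_lim_metric)
  then have "(\<lambda>(x, y). V x y) \<in> borel_measurable (M \<Otimes>\<^sub>M M)"
    unfolding V_def case_prod_beta by simp
  moreover have "AE y in M. V x y = W x y" if x: "x \<in> space M" for x
    using AE_sections_converge[OF x d(1) s[OF x]] AE_space
  proof eventually_elim
    case (elim y)
    then have "lim (\<lambda>n. W (d (s n x)) y) = W x y" by (intro limI)
    then show ?case using range_W[OF x elim(2)] by (simp add: V_def)
  qed
  ultimately show ?thesis using that[of V] by (auto simp: V_def)
qed

text \<open>Equality on almost all pairs follows from equality on rows only for functions measurable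
  on the plain product. Hence the detour through a measurable modification \<open>W'\<close> of
  \<open>W\<close>.\<close>

lemma AE_pair_version:
  assumes V: "(\<lambda>(x, y). V x y) \<in> borel_measurable (M \<Otimes>\<^sub>M M)"
    and eq: "\<And>x. x \<in> space M \<Longrightarrow> AE y in M. V x y = W x y"
  shows "AE (x, y) in M \<Otimes>\<^sub>M M. V x y = W x y"
proof -
  interpret pair_sigma_finite M M ..
  obtain W' where W': "W' \<in> borel_measurable (M \<Otimes>\<^sub>M M)" "AE p in M \<Otimes>\<^sub>M M. (\<lambda>(x, y). W x y) p = W' p"
    using completion_ex_borel_measurable_real[OF measurable_W] by blast
  have "AE x in M. AE y in M. (\<lambda>(x, y). W x y) (x, y) = W' (x, y)"
    by (rule AE_pair[OF W'(2)])
  then have "AE x in M. AE y in M. V x y = W' (x, y)"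
    using AE_space
  proof eventually_elim
    case (elim x)
    from elim(1) eq[OF elim(2)] show ?case by eventually_elim simp
  qed
  then have "AE p in M \<Otimes>\<^sub>M M. V (fst p) (snd p) = W' p"
    using V W'(1) by (intro AE_pair_measure) (auto simp: case_prod_beta)
  with W'(2) show ?thesis
    by eventually_elim (auto simp: case_prod_beta)
qed

text \<open>The inner product of two sections in \<open>L2\<close>, and the density of the two-edge
  path with labeled ends.\<close>

definition codegree :: "'a \<Rightarrow> 'a \<Rightarrow> real" where
  "codegree x y = (\<integral>z. W x z * W y z \<partial>M)"

lemma codegree_commute: "codegree x y = codegree y x"
  by (simp add: codegree_def mult.commute)

lemma integrable_section_mult:
  assumes "x \<in> space M" "y \<in> space M"
  shows "integrable M (\<lambda>z. W x z * W y z)"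
  by (rule integrable_unit_interval)
     (use assms measurable_section range_W in \<open>auto intro!: mult_le_one mult_nonneg_nonneg\<close>)

lemma codegree_lipschitz:
  assumes "x \<in> space M" "y \<in> space M" "u \<in> space M"
  shows "\<bar>codegree x u - codegree y u\<bar> \<le> r x y"
proof -
  have "codegree x u - codegree y u = (\<integral>z. (W x z - W y z) * W u z \<partial>M)"
    unfolding codegree_def using assms integrable_section_mult by (simp add: left_diff_distrib)
  also have "\<bar>\<dots>\<bar> \<le> (\<integral>z. \<bar>(W x z - W y z) * W u z\<bar> \<partial>M)"
    by (rule integral_abs_bound)
  also have "\<dots> \<le> (\<integral>z. \<bar>W x z - W y z\<bar> \<partial>M)"
  proof (rule integral_mono)
    show "integrable M (\<lambda>z. \<bar>(W x z - W y z) * W u z\<bar>)"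
      using assms integrable_section_mult by (simp add: left_diff_distrib)
    show "\<bar>(W x z - W y z) * W u z\<bar> \<le> \<bar>W x z - W y z\<bar>" if "z \<in> space M" for z
      using range_W[OF assms(3) that] by (simp add: abs_mult mult_left_le)
  qed (use assms integrable_section_diff in auto)
  finally show ?thesis by (simp add: graphon_dist_def)
qed

text \<open>
  Conversely, closeness of the codegrees forces closeness in \<^term>\<open>r\<close>, since
  \<open>\<parallel>W x - W y\<parallel>\<^sub>2\<^sup>2 = (codegree x x - codegree y x) - (codegree x y - codegree y y)\<close>.
\<close>
lemma dist_le_codegree:
  assumes xy: "x \<in> space M" "y \<in> space M"
    and e: "\<And>u. u \<in> space M \<Longrightarrow> \<bar>codegree x u - codegree y u\<bar> \<le> e"
  shows "(r x y)\<^sup>2 \<le> 2 * e"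
proof -
  let ?f = "\<lambda>z. \<bar>W x z - W y z\<bar>"
  note int = integrable_section_diff[OF xy] integrable_section_mult[OF xy] integrable_section_mult[OF xy(1,1)]
    integrable_section_mult[OF xy(2,2)] integrable_section_mult[OF xy(2,1)]
  have sq: "(?f z)\<^sup>2 = W x z * W x z - W y z * W x z - (W x z * W y z - W y z * W y z)" for z
    by (simp add: power2_eq_square algebra_simps)
  have "integrable M (\<lambda>z. (?f z)\<^sup>2)" unfolding sq using int by simp
  \<comment> \<open>Cauchy--Schwarz, in the form that the variance of \<open>?f\<close> is
    nonnegative.\<close>
  then have "(r x y)\<^sup>2 \<le> (\<integral>z. (?f z)\<^sup>2 \<partial>M)"
    using variance_eq[OF int(1)] variance_positive[of ?f] unfolding graphon_dist_def by simp
  also have "\<dots> = (codegree x x - codegree y x) - (codegree x y - codegree y y)"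
    unfolding sq codegree_def using int by (simp add: mult.commute[of "W y _" "W x _"])
  also have "\<dots> \<le> 2 * e"
    using e[OF xy(1)] e[OF xy(2)] by linarith
  finally show ?thesis .
qed

end

section \<open>Densities of rooted graphs\<close>

definition edge_weight :: "('a \<Rightarrow> 'a \<Rightarrow> real) \<Rightarrow> (nat \<times> nat) set \<Rightarrow> (nat \<Rightarrow> 'a) \<Rightarrow> real" where
  "edge_weight V E q = (\<Prod>(i, j)\<in>E. V (q i) (q j))"

text \<open>The product measure is not completed: the kernel will be a version of \<open>W\<close>
  that is measurable on the plain product, where Fubini applies directly.\<close>

definition rooted_density ::
  "'a measure \<Rightarrow> ('a \<Rightarrow> 'a \<Rightarrow> real) \<Rightarrow> nat set \<Rightarrow> (nat \<times> nat) set \<Rightarrow> (nat \<Rightarrow> 'a) \<Rightarrow> real" where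
  "rooted_density M V U E p =
     (\<integral>\<omega>. edge_weight V E (\<lambda>i. if i \<in> U then \<omega> i else p i) \<partial>(\<Pi>\<^sub>M i\<in>U. M))"

text \<open>
  Graphs with roots \<open>{1..n}\<close>, other nodes \<open>U\<close> and no edge between two roots. Edges are pairs
  directed upwards; thus every root precedes its neighbours, and gluing two such graphs along
  their roots never produces a multiple edge.
\<close>
definition rooted_graph :: "nat \<Rightarrow> nat set \<Rightarrow> (nat \<times> nat) set \<Rightarrow> bool" where
  "rooted_graph n U E \<longleftrightarrow> finite U \<and> U \<subseteq> {n<..} \<and> E \<subseteq> {(i, j). i < j \<and> j \<in> U \<and> i \<in> {1..n} \<union> U}"

lemma rooted_graph_finite_edges: "rooted_graph n U E \<Longrightarrow> finite E"
  by (rule finite_subset[of _ "({1..n} \<union> U) \<times> U"]) (auto simp: rooted_graph_def)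

lemma rooted_graph_empty: "rooted_graph n {} {}"
  by (simp add: rooted_graph_def)

text \<open>Used when the last root is integrated out and becomes the smallest free node.\<close>

lemma rooted_graph_unroot:
  "rooted_graph (Suc n) U E \<Longrightarrow> rooted_graph n (insert (Suc n) U) E"
  by (force simp: rooted_graph_def)

definition shift_node :: "nat \<Rightarrow> nat \<Rightarrow> nat \<Rightarrow> nat" where
  "shift_node n N i = (if i \<le> n then i else i + N)"

lemma inj_shift_node: "inj (shift_node n N)"
  by (auto simp: inj_on_def shift_node_def split: if_splits)

lemma rooted_graph_shift:
  assumes "rooted_graph n U E"
  shows "rooted_graph n (shift_node n N ` U) (map_prod (shift_node n N) (shift_node n N) ` E)"
proof -
  have "shift_node n N i < shift_node n N j \<and> shift_node n N j \<in> shift_node n N ` U \<and>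
      shift_node n N i \<in> {1..n} \<union> shift_node n N ` U" if "(i, j) \<in> E" for i j
    using assms that by (fastforce simp: rooted_graph_def shift_node_def)
  then show ?thesis
    using assms by (fastforce simp: rooted_graph_def shift_node_def)
qed

locale measurable_kernel = prob_space M for M :: "'a measure" +
  fixes V :: "'a \<Rightarrow> 'a \<Rightarrow> real"
  assumes measurable_V: "(\<lambda>(x, y). V x y) \<in> borel_measurable (M \<Otimes>\<^sub>M M)"
    and range_V: "V x y \<in> {0..1}"
begin

lemma measurable_edge_weight:
  assumes "\<And>i j. (i, j) \<in> E \<Longrightarrow> Q i \<in> measurable N M" "\<And>i j. (i, j) \<in> E \<Longrightarrow> Q j \<in> measurable N M"
  shows "(\<lambda>w. edge_weight V E (\<lambda>i. Q i w)) \<in> borel_measurable N"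
  unfolding edge_weight_def
proof (rule borel_measurable_prod)
  fix e assume e: "e \<in> E"
  obtain i j where ij: "e = (i, j)" by (cases e)
  have "(\<lambda>w. (Q i w, Q j w)) \<in> measurable N (M \<Otimes>\<^sub>M M)"
    using assms e ij by (intro measurable_Pair) auto
  from measurable_compose[OF this measurable_V]
  show "(\<lambda>w. case e of (i, j) \<Rightarrow> V (Q i w) (Q j w)) \<in> borel_measurable N"
    by (simp add: ij)
qed

lemma edge_weight_unit_interval: "edge_weight V E q \<in> {0..1}"
  unfolding edge_weight_def using range_V by (auto intro!: prod_nonneg prod_le_1)

lemma measurable_nodes:
  assumes "\<And>i. p i \<in> space M"
  shows "(\<lambda>\<omega>. if i \<in> U then \<omega> i else p i) \<in> measurable (\<Pi>\<^sub>M i\<in>U. M) M"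
  using assms by (cases "i \<in> U") auto

lemma measurable_nodes_update:
  assumes "\<And>i. p i \<in> space M"
  shows "(\<lambda>w. if i \<in> U then snd w i else (p(r := fst w)) i) \<in> measurable (M \<Otimes>\<^sub>M (\<Pi>\<^sub>M i\<in>U. M)) M"
proof (cases "i \<in> U")
  case True
  then show ?thesis
    using measurable_compose[OF measurable_snd measurable_component_singleton[OF True]] by simp
next
  case False
  then show ?thesis using assms by (cases "i = r") auto
qed

lemma integrable_edge_weight:
  assumes p: "\<And>i. p i \<in> space M"
  shows "integrable (\<Pi>\<^sub>M i\<in>U. M) (\<lambda>\<omega>. edge_weight V E (\<lambda>i. if i \<in> U then \<omega> i else p i))"
proof -
  interpret P: prob_space "\<Pi>\<^sub>M i\<in>U. M" by (rule prob_space_PiM) (rule prob_space_axioms)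
  show ?thesis
    by (intro P.integrable_unit_interval measurable_edge_weight edge_weight_unit_interval measurable_nodes p)
qed

lemma rooted_density_unit_interval:
  assumes p: "\<And>i. p i \<in> space M"
  shows "rooted_density M V U E p \<in> {0..1}"
proof -
  interpret P: prob_space "\<Pi>\<^sub>M i\<in>U. M" by (rule prob_space_PiM) (rule prob_space_axioms)
  show ?thesis
    unfolding rooted_density_def atLeastAtMost_iff
    using edge_weight_unit_interval
    by (intro conjI Bochner_Integration.integral_nonneg P.integral_le_const integrable_edge_weight p) auto
qed

lemma measurable_rooted_density:
  assumes p: "\<And>i. p i \<in> space M"
  shows "(\<lambda>x. rooted_density M V U E (p(r := x))) \<in> borel_measurable M"
proof -
  interpret P: prob_space "\<Pi>\<^sub>M i\<in>U. M" by (rule prob_space_PiM) (rule prob_space_axioms)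
  have "(\<lambda>w. edge_weight V E (\<lambda>i. if i \<in> U then snd w i else (p(r := fst w)) i))
      \<in> borel_measurable (M \<Otimes>\<^sub>M (\<Pi>\<^sub>M i\<in>U. M))"
    by (intro measurable_edge_weight measurable_nodes_update p)
  then show ?thesis
    unfolding rooted_density_def
    by (intro P.borel_measurable_lebesgue_integral) (simp add: case_prod_beta)
qed

lemma rooted_density_insert:
  assumes p: "\<And>i. p i \<in> space M" and U: "finite U" "r \<notin> U"
  shows "rooted_density M V (insert r U) E p = (\<integral>x. rooted_density M V U E (p(r := x)) \<partial>M)"
proof -
  interpret P: product_sigma_finite "\<lambda>_::nat. M" ..
  let ?f = "\<lambda>\<omega>. edge_weight V E (\<lambda>i. if i \<in> {r} \<union> U then \<omega> i else p i)"
  have "rooted_density M V (insert r U) E p = integral\<^sup>L (\<Pi>\<^sub>M i\<in>{r} \<union> U. M) ?f"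
    unfolding rooted_density_def by simp
  also have "\<dots> = (\<integral>x. (\<integral>y. ?f (merge {r} U (x, y)) \<partial>(\<Pi>\<^sub>M i\<in>U. M)) \<partial>(\<Pi>\<^sub>M i\<in>{r}. M))"
    using U integrable_edge_weight[OF p, of "{r} \<union> U"] by (intro P.product_integral_fold) auto
  also have "\<dots> = (\<integral>x. rooted_density M V U E (p(r := x r)) \<partial>(\<Pi>\<^sub>M i\<in>{r}. M))"
    unfolding rooted_density_def using U
    by (intro Bochner_Integration.integral_cong refl arg_cong[where f = "edge_weight V E"]) (auto simp: merge_def)
  also have "\<dots> = (\<integral>x. rooted_density M V U E (p(r := x)) \<partial>M)"
    using measurable_rooted_density[OF p] by (intro P.product_integral_singleton)
  finally show ?thesis .
qed

text \<open>No edge of one graph meets a free node of the other, so the integrand splits into two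
  factors with separate variables.\<close>

lemma rooted_density_mult:
  assumes p: "\<And>i. p i \<in> space M" and U: "finite U1" "finite U2" "U1 \<inter> U2 = {}"
    and E: "finite E1" "finite E2" "E1 \<inter> E2 = {}"
    and sep: "\<And>i j. (i, j) \<in> E1 \<Longrightarrow> i \<notin> U2 \<and> j \<notin> U2" "\<And>i j. (i, j) \<in> E2 \<Longrightarrow> i \<notin> U1 \<and> j \<notin> U1"
  shows "rooted_density M V (U1 \<union> U2) (E1 \<union> E2) p = rooted_density M V U1 E1 p * rooted_density M V U2 E2 p"
proof -
  interpret P: product_sigma_finite "\<lambda>_::nat. M" ..
  let ?f = "\<lambda>\<omega>. edge_weight V (E1 \<union> E2) (\<lambda>i. if i \<in> U1 \<union> U2 then \<omega> i else p i)"
  let ?g = "\<lambda>U E \<omega>. edge_weight V E (\<lambda>i. if i \<in> U then \<omega> i else p i)"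
  have *: "?f (merge U1 U2 (x, y)) = ?g U1 E1 x * ?g U2 E2 y" for x y
  proof -
    have "?f (merge U1 U2 (x, y)) =
        edge_weight V E1 (\<lambda>i. if i \<in> U1 \<union> U2 then merge U1 U2 (x, y) i else p i) *
        edge_weight V E2 (\<lambda>i. if i \<in> U1 \<union> U2 then merge U1 U2 (x, y) i else p i)"
      unfolding edge_weight_def using E by (rule prod.union_disjoint)
    also have "edge_weight V E1 (\<lambda>i. if i \<in> U1 \<union> U2 then merge U1 U2 (x, y) i else p i) = ?g U1 E1 x"
      unfolding edge_weight_def using sep(1) by (intro prod.cong) (auto simp: merge_def)
    also have "edge_weight V E2 (\<lambda>i. if i \<in> U1 \<union> U2 then merge U1 U2 (x, y) i else p i) = ?g U2 E2 y"
      unfolding edge_weight_def using sep(2) by (intro prod.cong) (auto simp: merge_def)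
    finally show ?thesis .
  qed
  have "rooted_density M V (U1 \<union> U2) (E1 \<union> E2) p =
      (\<integral>x. (\<integral>y. ?f (merge U1 U2 (x, y)) \<partial>(\<Pi>\<^sub>M i\<in>U2. M)) \<partial>(\<Pi>\<^sub>M i\<in>U1. M))"
    unfolding rooted_density_def using U integrable_edge_weight[OF p] by (intro P.product_integral_fold)
  also have "\<dots> = rooted_density M V U1 E1 p * rooted_density M V U2 E2 p"
    unfolding * rooted_density_def by simp
  finally show ?thesis .
qed

text \<open>The coordinates are independent and identically distributed, so an injective reindexing
  preserves the product measure.\<close>

lemma rooted_density_rename:
  assumes p: "\<And>i. p i \<in> space M" and \<sigma>: "inj \<sigma>" "\<And>i j. (i, j) \<in> E \<Longrightarrow> (i \<notin> U \<longrightarrow> p (\<sigma> i) = p i) \<and> (j \<notin> U \<longrightarrow> p (\<sigma> j) = p j)"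
  shows "rooted_density M V (\<sigma> ` U) (map_prod \<sigma> \<sigma> ` E) p = rooted_density M V U E p"
proof -
  let ?g = "\<lambda>U E \<omega>. edge_weight V E (\<lambda>i. if i \<in> U then \<omega> i else p i)"
  let ?t = "\<lambda>\<omega>. \<lambda>n\<in>U. \<omega> (\<sigma> n)"
  have t: "?t \<in> measurable (\<Pi>\<^sub>M i\<in>\<sigma> ` U. M) (\<Pi>\<^sub>M i\<in>U. M)"
    by (intro measurable_restrict measurable_component_singleton) auto
  have "distr (\<Pi>\<^sub>M i\<in>\<sigma> ` U. M) (\<Pi>\<^sub>M i\<in>U. M) ?t = (\<Pi>\<^sub>M i\<in>U. M)"
    using \<sigma>(1) prob_space_axioms by (intro distr_PiM_reindex) (auto intro: inj_on_subset)
  then have "rooted_density M V U E p = integral\<^sup>L (distr (\<Pi>\<^sub>M i\<in>\<sigma> ` U. M) (\<Pi>\<^sub>M i\<in>U. M) ?t) (?g U E)"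
    by (simp add: rooted_density_def)
  also have "\<dots> = (\<integral>\<omega>. ?g U E (?t \<omega>) \<partial>(\<Pi>\<^sub>M i\<in>\<sigma> ` U. M))"
    using integrable_edge_weight[OF p] by (intro integral_distr[OF t]) auto
  also have "\<dots> = rooted_density M V (\<sigma> ` U) (map_prod \<sigma> \<sigma> ` E) p"
    unfolding rooted_density_def edge_weight_def
  proof (intro Bochner_Integration.integral_cong refl)
    fix \<omega>
    have "inj_on (map_prod \<sigma> \<sigma>) E"
      using \<sigma>(1) by (auto simp: inj_on_def)
    then have "(\<Prod>(i, j)\<in>map_prod \<sigma> \<sigma> ` E. V (if i \<in> \<sigma> ` U then \<omega> i else p i) (if j \<in> \<sigma> ` U then \<omega> j else p j)) =
        (\<Prod>(i, j)\<in>E. V (if \<sigma> i \<in> \<sigma> ` U then \<omega> (\<sigma> i) else p (\<sigma> i)) (if \<sigma> j \<in> \<sigma> ` U then \<omega> (\<sigma> j) else p (\<sigma> j)))"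
      by (subst prod.reindex) (auto simp: case_prod_beta intro!: prod.cong)
    also have "\<dots> = (\<Prod>(i, j)\<in>E. V (if i \<in> U then ?t \<omega> i else p i) (if j \<in> U then ?t \<omega> j else p j))"
      using \<sigma> by (intro prod.cong) (auto simp: inj_image_mem_iff)
    finally show "(\<Prod>(i, j)\<in>E. V (if i \<in> U then ?t \<omega> i else p i) (if j \<in> U then ?t \<omega> j else p j)) =
       (\<Prod>(i, j)\<in>map_prod \<sigma> \<sigma> ` E. V (if i \<in> \<sigma> ` U then \<omega> i else p i) (if j \<in> \<sigma> ` U then \<omega> j else p j))" ..
  qed
  finally show ?thesis ..
qed

lemma rooted_density_empty: "rooted_density M V {} {} p = 1"
proof -
  interpret P: prob_space "\<Pi>\<^sub>M i\<in>({}::nat set). M" by (rule prob_space_PiM) (rule prob_space_axioms)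
  show ?thesis by (simp add: rooted_density_def edge_weight_def P.prob_space)
qed

lemma rooted_density_shift:
  assumes "rooted_graph n U E" and p: "\<And>i. p i \<in> space M"
  shows "rooted_density M V (shift_node n N ` U) (map_prod (shift_node n N) (shift_node n N) ` E) p = rooted_density M V U E p"
  using assms(1) by (intro rooted_density_rename p inj_shift_node) (auto simp: rooted_graph_def shift_node_def)

end

lemma rooted_density_cong:
  assumes "rooted_graph n U E" "\<And>i. i \<in> {1..n} \<Longrightarrow> p i = q i"
  shows "rooted_density M V U E p = rooted_density M V U E q"
  unfolding rooted_density_def edge_weight_def using assms
  by (intro Bochner_Integration.integral_cong refl prod.cong) (auto simp: rooted_graph_def)

text \<open>The sum of the nodes of \<open>F\<close> is a crude upper bound for each of them.
  Shifting the free nodes of \<open>G\<close> by it separates them from those of \<open>F\<close>,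
  while the roots stay identified.\<close>

definition glue :: "nat \<Rightarrow> nat set \<times> (nat \<times> nat) set \<Rightarrow> nat set \<times> (nat \<times> nat) set \<Rightarrow> nat set \<times> (nat \<times> nat) set" where
  "glue n F G =
     (let s = shift_node n (\<Sum>(fst F)) in (fst F \<union> s ` fst G, snd F \<union> map_prod s s ` snd G))"

lemma shift_node_disjoint:
  assumes "rooted_graph n U1 E1" "rooted_graph n U2 E2"
  shows "U1 \<inter> shift_node n (\<Sum>U1) ` U2 = {}"
proof -
  have "i \<le> \<Sum>U1" if "i \<in> U1" for i
    using assms(1) that by (intro member_le_sum) (auto simp: rooted_graph_def)
  then show ?thesis
    using assms(2) by (fastforce simp: rooted_graph_def shift_node_def)
qed

lemma rooted_graph_glue:
  assumes "rooted_graph n (fst F) (snd F)" "rooted_graph n (fst G) (snd G)"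
  shows "rooted_graph n (fst (glue n F G)) (snd (glue n F G))"
  using assms(1) rooted_graph_shift[OF assms(2), of "\<Sum>(fst F)"]
  unfolding rooted_graph_def glue_def Let_def by auto

lemma (in measurable_kernel) rooted_density_glue:
  assumes F: "rooted_graph n (fst F) (snd F)" and G: "rooted_graph n (fst G) (snd G)"
    and p: "\<And>i. p i \<in> space M"
  shows "rooted_density M V (fst (glue n F G)) (snd (glue n F G)) p =
    rooted_density M V (fst F) (snd F) p * rooted_density M V (fst G) (snd G) p"
proof -
  obtain U1 E1 U2 E2 where FG: "F = (U1, E1)" "G = (U2, E2)"
    by (metis surj_pair)
  with F G have assms: "rooted_graph n U1 E1" "rooted_graph n U2 E2" by simp_all
  define U2' where "U2' = shift_node n (\<Sum>U1) ` U2"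
  define E2' where "E2' = map_prod (shift_node n (\<Sum>U1)) (shift_node n (\<Sum>U1)) ` E2"
  have g: "rooted_graph n U2' E2'"
    unfolding U2'_def E2'_def using assms(2) by (rule rooted_graph_shift)
  have disj: "U1 \<inter> U2' = {}"
    unfolding U2'_def using assms(1,2) by (rule shift_node_disjoint)
  have sep: "i \<notin> U' \<and> j \<notin> U'" if "(i, j) \<in> F" "rooted_graph n A F" "rooted_graph n U' F'" "A \<inter> U' = {}"
    for i j A F U' F'
  proof -
    have "j \<in> A" "i \<in> {1..n} \<union> A" "U' \<subseteq> {n<..}" using that unfolding rooted_graph_def by auto
    then show ?thesis using that(4) by auto
  qed
  have sep1: "i \<notin> U2' \<and> j \<notin> U2'" if "(i, j) \<in> E1" for i j
    using sep[OF that assms(1) g disj] .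
  have sep2: "i \<notin> U1 \<and> j \<notin> U1" if "(i, j) \<in> E2'" for i j
    using sep[OF that g assms(1)] disj by blast
  have snd_in: "j \<in> U1" if "(i, j) \<in> E1" for i j
    using that assms(1) unfolding rooted_graph_def by auto
  have "E1 \<inter> E2' = {}"
    using snd_in sep2 by (metis Int_emptyI surj_pair)
  then have "rooted_density M V (U1 \<union> U2') (E1 \<union> E2') p =
      rooted_density M V U1 E1 p * rooted_density M V U2' E2' p"
    using disj sep1 sep2 rooted_graph_finite_edges[OF assms(1)] rooted_graph_finite_edges[OF g] assms(1) g
    by (intro rooted_density_mult p) (simp_all add: rooted_graph_def)
  moreover have "glue n F G = (U1 \<union> U2', E1 \<union> E2')"
    by (simp add: glue_def Let_def FG U2'_def E2'_def)
  ultimately show ?thesis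
    using rooted_density_shift[OF assms(2) p] by (simp add: U2'_def E2'_def FG)
qed

text \<open>Lists serve as codes because the moment lemma needs a countable index type. A pair of
  lists that is no rooted graph is read as the empty graph, which has density 1.\<close>

definition rooted_graph_of :: "nat \<Rightarrow> nat list \<times> (nat \<times> nat) list \<Rightarrow> nat set \<times> (nat \<times> nat) set" where
  "rooted_graph_of n c =
     (if rooted_graph n (set (fst c)) (set (snd c)) then (set (fst c), set (snd c)) else ({}, {}))"

lemma rooted_graph_of: "rooted_graph n (fst (rooted_graph_of n c)) (snd (rooted_graph_of n c))"
  by (simp add: rooted_graph_of_def rooted_graph_empty)

lemma rooted_graph_of_surj:
  assumes "rooted_graph n U E"
  shows "\<exists>c. rooted_graph_of n c = (U, E)"
proof -
  obtain us es where "set us = U" "set es = E"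
    using assms rooted_graph_finite_edges[OF assms] finite_list unfolding rooted_graph_def by metis
  then show ?thesis
    using assms by (intro exI[of _ "(us, es)"]) (simp add: rooted_graph_of_def)
qed

definition glue_list :: "nat \<Rightarrow> (nat list \<times> (nat \<times> nat) list) list \<Rightarrow> nat set \<times> (nat \<times> nat) set" where
  "glue_list n cs = foldr (\<lambda>c. glue n (rooted_graph_of n c)) cs ({}, {})"

lemma rooted_graph_glue_list: "rooted_graph n (fst (glue_list n cs)) (snd (glue_list n cs))"
proof (induction cs)
  case Nil
  show ?case by (simp add: glue_list_def rooted_graph_empty)
next
  case (Cons c cs)
  from rooted_graph_glue[OF rooted_graph_of this] show ?case
    by (simp add: glue_list_def)
qed

definition root_profile ::
  "'a measure \<Rightarrow> ('a \<Rightarrow> 'a \<Rightarrow> real) \<Rightarrow> nat \<Rightarrow> (nat \<Rightarrow> 'a) \<Rightarrow> nat list \<times> (nat \<times> nat) list \<Rightarrow> real" where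
  "root_profile M V n p c = rooted_density M V (fst (rooted_graph_of n c)) (snd (rooted_graph_of n c)) p"

text \<open>Densities are multiplicative under gluing, so each monomial in the coordinates of the
  profile is again a single density.\<close>

lemma (in measurable_kernel) prod_root_profile:
  assumes p: "\<And>i. p i \<in> space M"
  shows "(\<Prod>c\<leftarrow>cs. root_profile M V n p c) = rooted_density M V (fst (glue_list n cs)) (snd (glue_list n cs)) p"
proof (induction cs)
  case Nil
  show ?case by (simp add: glue_list_def rooted_density_empty)
next
  case (Cons c cs)
  have "glue_list n (c # cs) = glue n (rooted_graph_of n c) (glue_list n cs)"
    by (simp add: glue_list_def)
  then show ?case
    using rooted_density_glue[OF rooted_graph_of rooted_graph_glue_list p] Cons.IH
    by (simp add: root_profile_def)
qed

definition same_densities ::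
  "'a measure \<Rightarrow> ('a \<Rightarrow> 'a \<Rightarrow> real) \<Rightarrow> 'b measure \<Rightarrow> ('b \<Rightarrow> 'b \<Rightarrow> real) \<Rightarrow> nat \<Rightarrow> (nat \<Rightarrow> 'a) \<Rightarrow> (nat \<Rightarrow> 'b) \<Rightarrow> bool" where
  "same_densities M1 V1 M2 V2 n p q \<longleftrightarrow>
     (\<forall>U E. rooted_graph n U E \<longrightarrow> rooted_density M1 V1 U E p = rooted_density M2 V2 U E q)"

lemma same_densities_commute:
  "same_densities M1 V1 M2 V2 n p q \<longleftrightarrow> same_densities M2 V2 M1 V1 n q p"
  by (auto simp: same_densities_def)

section \<open>Adding a root\<close>

text \<open>Averaging over the last root makes it a free node. Hence all joint moments of the
  profile of one random further root are densities with only \<open>n\<close> roots.\<close>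

lemma (in measurable_kernel) integral_prod_root_profile:
  assumes p: "\<And>i. p i \<in> space M"
  shows "(\<integral>x. (\<Prod>c\<leftarrow>cs. root_profile M V (Suc n) (p(Suc n := x)) c) \<partial>M) =
    rooted_density M V (insert (Suc n) (fst (glue_list (Suc n) cs))) (snd (glue_list (Suc n) cs)) p"
proof -
  have "(\<integral>x. (\<Prod>c\<leftarrow>cs. root_profile M V (Suc n) (p(Suc n := x)) c) \<partial>M) =
      (\<integral>x. rooted_density M V (fst (glue_list (Suc n) cs)) (snd (glue_list (Suc n) cs)) (p(Suc n := x)) \<partial>M)"
    using p by (intro Bochner_Integration.integral_cong refl prod_root_profile) simp
  also have "\<dots> = rooted_density M V (insert (Suc n) (fst (glue_list (Suc n) cs))) (snd (glue_list (Suc n) cs)) p"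
    using rooted_graph_glue_list[of "Suc n" cs]
    by (intro rooted_density_insert[OF p, symmetric]) (auto simp: rooted_graph_def)
  finally show ?thesis .
qed

lemma (in measurable_kernel) measurable_root_profile:
  assumes p: "\<And>i. p i \<in> space M"
  shows "(\<lambda>x. root_profile M V n (p(r := x))) \<in> borel_measurable M"
  unfolding root_profile_def
  by (intro measurable_coordinatewise_then_product measurable_rooted_density p)

lemma same_densities_moments:
  assumes "measurable_kernel M1 V1" "measurable_kernel M2 V2"
    and p: "\<And>i. p i \<in> space M1" and q: "\<And>i. q i \<in> space M2"
    and same: "same_densities M1 V1 M2 V2 n p q"
  shows "(\<integral>x. (\<Prod>c\<leftarrow>cs. root_profile M1 V1 (Suc n) (p(Suc n := x)) c) \<partial>M1) =
    (\<integral>x. (\<Prod>c\<leftarrow>cs. root_profile M2 V2 (Suc n) (q(Suc n := x)) c) \<partial>M2)"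
  unfolding measurable_kernel.integral_prod_root_profile[OF assms(1) p] measurable_kernel.integral_prod_root_profile[OF assms(2) q]
  using same rooted_graph_unroot[OF rooted_graph_glue_list] unfolding same_densities_def by blast

text \<open>All densities with one more root are collected into one map to a countable power of the
  line, so a single common value of the two maps settles all graphs at once.\<close>

lemma same_densities_extend:
  assumes k1: "measurable_kernel M1 V1" and k2: "measurable_kernel M2 V2"
    and std: "standard_prob_space M1" "standard_prob_space M2"
    and p: "\<And>i. p i \<in> space M1" and q: "\<And>i. q i \<in> space M2"
    and same: "same_densities M1 V1 M2 V2 n p q"
    and A: "A \<in> sets M1" "emeasure M1 A > 0"
  shows "\<exists>x\<in>A. \<exists>y\<in>space M2. same_densities M1 V1 M2 V2 (Suc n) (p(Suc n := x)) (q(Suc n := y))"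
proof -
  interpret k1: measurable_kernel M1 V1 by fact
  interpret k2: measurable_kernel M2 V2 by fact
  let ?f = "\<lambda>x. root_profile M1 V1 (Suc n) (p(Suc n := x))"
  let ?g = "\<lambda>x. root_profile M2 V2 (Suc n) (q(Suc n := x))"
  have f: "?f \<in> borel_measurable M1" and g: "?g \<in> borel_measurable M2"
    by (intro k1.measurable_root_profile p k2.measurable_root_profile q)+
  have "distr M1 borel ?f = distr M2 borel ?g"
  proof (rule moments_determine_distr[OF _ _ f g])
    show "?f x c \<in> {0..1}" if "x \<in> space M1" for x c
      unfolding root_profile_def using that p by (intro k1.rooted_density_unit_interval) simp
    show "?g x c \<in> {0..1}" if "x \<in> space M2" for x c
      unfolding root_profile_def using that q by (intro k2.rooted_density_unit_interval) simp
    show "(\<integral>x. (\<Prod>c\<leftarrow>cs. ?f x c) \<partial>M1) = (\<integral>x. (\<Prod>c\<leftarrow>cs. ?g x c) \<partial>M2)" for cs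
      by (rule same_densities_moments[OF k1 k2 p q same])
  qed unfold_locales
  then obtain x y where xy: "x \<in> A" "y \<in> space M2" "?f x = ?g y"
    using standard_prob_spaces_common_value[OF std f g _ A] by blast
  have "rooted_density M1 V1 U E (p(Suc n := x)) = rooted_density M2 V2 U E (q(Suc n := y))"
    if "rooted_graph (Suc n) U E" for U E
  proof -
    from rooted_graph_of_surj[OF that] obtain c where "rooted_graph_of (Suc n) c = (U, E)" ..
    with fun_cong[OF xy(3), of c] show ?thesis by (simp add: root_profile_def)
  qed
  then show ?thesis
    using xy(1,2) by (intro bexI[of _ x] bexI[of _ y]) (auto simp: same_densities_def)
qed

text \<open>\<open>E\<close> has no edge between two of its roots, in particular not
  \<open>(i, Suc n)\<close>. So one factor \<open>V (p i) u\<close> can be absorbed as a new edge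
  without creating a double edge.\<close>

lemma (in measurable_kernel) integral_root_edge:
  assumes p: "\<And>i. p i \<in> space M" and G: "rooted_graph (Suc n) U E" and i: "i \<in> {1..n}"
  shows "(\<integral>u. V (p i) u * rooted_density M V U E (p(Suc n := u)) \<partial>M) =
      rooted_density M V (insert (Suc n) U) (insert (i, Suc n) E) p"
    and "rooted_graph n (insert (Suc n) U) (insert (i, Suc n) E)"
proof -
  have notin: "(i, Suc n) \<notin> E" "i \<notin> U" "Suc n \<notin> U" "finite U" "finite E"
    using G i rooted_graph_finite_edges[OF G] by (auto simp: rooted_graph_def)
  have "rooted_density M V (insert (Suc n) U) (insert (i, Suc n) E) p =
      (\<integral>u. rooted_density M V U (insert (i, Suc n) E) (p(Suc n := u)) \<partial>M)"
    by (rule rooted_density_insert[OF p]) (use notin in auto)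
  also have "\<dots> = (\<integral>u. V (p i) u * rooted_density M V U E (p(Suc n := u)) \<partial>M)"
    unfolding rooted_density_def edge_weight_def using notin i by (simp add: prod.insert)
  finally show "(\<integral>u. V (p i) u * rooted_density M V U E (p(Suc n := u)) \<partial>M) =
      rooted_density M V (insert (Suc n) U) (insert (i, Suc n) E) p" ..
  show "rooted_graph n (insert (Suc n) U) (insert (i, Suc n) E)"
    using rooted_graph_unroot[OF G] i by (auto simp: rooted_graph_def)
qed

section \<open>Labeled densities expressed through the measurable version\<close>

lemma AE_PiM_pair:
  assumes M: "prob_space M" and U: "finite U" "i \<in> U" "j \<in> U" "i \<noteq> j"
    and P: "AE w in M \<Otimes>\<^sub>M M. P w"
  shows "AE \<omega> in \<Pi>\<^sub>M i\<in>U. M. P (\<omega> i, \<omega> j)"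
proof -
  interpret prob_space M by fact
  interpret product_sigma_finite "\<lambda>_. M" ..
  have meas: "(\<lambda>\<omega>. (\<omega> i, \<omega> j)) \<in> measurable (\<Pi>\<^sub>M i\<in>U. M) (M \<Otimes>\<^sub>M M)"
    using U by (intro measurable_Pair measurable_component_singleton)
  \<comment> \<open>Two different coordinates are independent with law \<open>M\<close>, so their
    joint law is the product; it suffices to check rectangles.\<close>
  have "M \<Otimes>\<^sub>M M = distr (\<Pi>\<^sub>M i\<in>U. M) (M \<Otimes>\<^sub>M M) (\<lambda>\<omega>. (\<omega> i, \<omega> j))"
  proof (rule pair_measure_eqI)
    fix A B assume AB: "A \<in> sets M" "B \<in> sets M"
    let ?C = "\<lambda>l. if l = i then A else if l = j then B else space M"
    have "(\<lambda>\<omega>. (\<omega> i, \<omega> j)) -` (A \<times> B) \<inter> space (\<Pi>\<^sub>M i\<in>U. M) = (\<Pi>\<^sub>E l\<in>U. ?C l)"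
    proof (intro equalityI subsetI)
      fix x assume x: "x \<in> (\<Pi>\<^sub>E l\<in>U. ?C l)"
      have C: "?C l \<subseteq> space M" for l using AB[THEN sets.sets_into_space] by simp
      have "x i \<in> ?C i" "x j \<in> ?C j" using x U(2,3) by (blast dest: PiE_mem)+
      moreover have "x \<in> (\<Pi>\<^sub>E l\<in>U. space M)" using x C by (blast dest: PiE_mono[THEN subsetD, rotated])
      ultimately show "x \<in> (\<lambda>\<omega>. (\<omega> i, \<omega> j)) -` (A \<times> B) \<inter> space (\<Pi>\<^sub>M i\<in>U. M)"
        using U(4) by (simp add: space_PiM)
    qed (auto simp: space_PiM PiE_iff)
    then have "emeasure (distr (\<Pi>\<^sub>M i\<in>U. M) (M \<Otimes>\<^sub>M M) (\<lambda>\<omega>. (\<omega> i, \<omega> j))) (A \<times> B) =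
        emeasure (\<Pi>\<^sub>M i\<in>U. M) (\<Pi>\<^sub>E l\<in>U. ?C l)"
      using AB by (subst emeasure_distr[OF meas]) auto
    also have "\<dots> = (\<Prod>l\<in>U. emeasure M (?C l))"
      using U AB by (intro emeasure_PiM) auto
    also have "\<dots> = emeasure M A * (\<Prod>l\<in>U - {i}. emeasure M (?C l))"
      using U by (subst prod.remove[of U i]) auto
    also have "(\<Prod>l\<in>U - {i}. emeasure M (?C l)) = emeasure M B * (\<Prod>l\<in>U - {i} - {j}. emeasure M (?C l))"
      using U by (subst prod.remove[of "U - {i}" j]) auto
    also have "(\<Prod>l\<in>U - {i} - {j}. emeasure M (?C l)) = 1"
      by (intro prod.neutral) (auto simp: emeasure_space_1)
    finally show "emeasure M A * emeasure M B =
        emeasure (distr (\<Pi>\<^sub>M i\<in>U. M) (M \<Otimes>\<^sub>M M) (\<lambda>\<omega>. (\<omega> i, \<omega> j))) (A \<times> B)"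
      by simp
  qed (auto intro: sigma_finite_measure_axioms)
  from subst[where P = "\<lambda>N. AE w in N. P w", OF this P]
  show ?thesis
    by (rule AE_distrD[OF meas])
qed

text \<open>No measurability of \<open>f\<close> is assumed: the completion supplies it, since
  \<open>f\<close> differs from \<open>g\<close> on a null set only.\<close>

lemma integral_completion_cong_AE:
  fixes f g :: "'a \<Rightarrow> real"
  assumes g: "g \<in> borel_measurable M" and eq: "AE x in M. f x = g x"
  shows "integral\<^sup>L (completion M) f = integral\<^sup>L M g"
proof -
  have eq': "AE x in completion M. f x = g x" using eq by (rule AE_completion)
  have g': "g \<in> borel_measurable (completion M)" using g by (rule measurable_completion)
  have "f \<in> borel_measurable (completion M)"
  proof (rule measurableI)
    fix S :: "real set" assume S: "S \<in> sets borel"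
    show "f -` S \<inter> space (completion M) \<in> sets (completion M)"
    proof (rule completion.in_sets_AE)
      show "g -` S \<inter> space (completion M) \<in> sets (completion M)"
        by (rule measurable_sets[OF g' S])
      show "AE x in completion M. x \<in> g -` S \<inter> space (completion M) \<longleftrightarrow> x \<in> f -` S \<inter> space (completion M)"
        using eq' by eventually_elim auto
    qed auto
  qed simp
  then have "integral\<^sup>L (completion M) f = integral\<^sup>L (completion M) g"
    using g' eq' by (rule integral_cong_AE)
  then show ?thesis
    using integral_completion[OF g] by simp
qed

locale graphon_version = pure_graphon +
  fixes V :: "'a \<Rightarrow> 'a \<Rightarrow> real"
  assumes measurable_V: "(\<lambda>(x, y). V x y) \<in> borel_measurable (M \<Otimes>\<^sub>M M)"
    and range_V: "V x y \<in> {0..1}"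
    and AE_V: "x \<in> space M \<Longrightarrow> AE y in M. V x y = W x y"

sublocale graphon_version \<subseteq> measurable_kernel M V
  by unfold_locales (rule measurable_V range_V)+

text \<open>An edge between two roots keeps \<open>W\<close>, because at a single pair of points
  \<open>V\<close> may have another value. Every other edge uses \<open>V\<close>, with a root
  always in the first argument: \<open>V\<close> is controlled row by row and need not be
  symmetric.\<close>

definition edge_factor ::
  "('a \<Rightarrow> 'a \<Rightarrow> real) \<Rightarrow> ('a \<Rightarrow> 'a \<Rightarrow> real) \<Rightarrow> nat \<Rightarrow> (nat \<Rightarrow> 'a) \<Rightarrow> nat \<times> nat \<Rightarrow> (nat \<Rightarrow> 'a) \<Rightarrow> real" where
  "edge_factor W V k a = (\<lambda>(i, j) \<omega>.
     if i \<in> {1..k} \<and> j \<in> {1..k} then W (a i) (a j)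
     else if i \<in> {1..k} then V (a i) (\<omega> j)
     else if j \<in> {1..k} then V (a j) (\<omega> i)
     else V (\<omega> i) (\<omega> j))"

context graphon_version
begin

lemma AE_V_pair: "AE (x, y) in M \<Otimes>\<^sub>M M. V x y = W x y"
  by (rule AE_pair_version[OF measurable_V AE_V])

lemma measurable_V_compose:
  "f \<in> measurable N M \<Longrightarrow> g \<in> measurable N M \<Longrightarrow> (\<lambda>w. V (f w) (g w)) \<in> borel_measurable N"
  using measurable_compose[OF measurable_Pair measurable_V] by simp

lemma measurable_edge_factor:
  assumes a: "a \<in> {1..k} \<rightarrow> space M" and ij: "i \<in> {1..k} \<union> U" "j \<in> {1..k} \<union> U"
  shows "edge_factor W V k a (i, j) \<in> borel_measurable (\<Pi>\<^sub>M i\<in>U. M)"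
proof -
  have c: "(\<lambda>\<omega>. \<omega> l) \<in> measurable (\<Pi>\<^sub>M i\<in>U. M) M" if "l \<in> U" for l
    using that by (rule measurable_component_singleton)
  have d: "(\<lambda>_. a l) \<in> measurable (\<Pi>\<^sub>M i\<in>U. M) M" if "l \<in> {1..k}" for l
    using that by (intro measurable_const Pi_mem[OF a])
  show ?thesis
    using ij
    by (cases "i \<in> {1..k}"; cases "j \<in> {1..k}")
      (simp_all del: atLeastAtMost_iff add: edge_factor_def c d measurable_V_compose)
qed

lemma AE_edge_factor:
  assumes a: "a \<in> {1..k} \<rightarrow> space M" and ij: "i \<in> {1..k} \<union> U" "j \<in> {1..k} \<union> U" "i \<noteq> j"
    and U: "finite U" "U \<inter> {1..k} = {}"
  shows "AE \<omega> in \<Pi>\<^sub>M i\<in>U. M.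
    W (if i \<in> {1..k} then a i else \<omega> i) (if j \<in> {1..k} then a j else \<omega> j) = edge_factor W V k a (i, j) \<omega>"
proof -
  have root: "AE \<omega> in \<Pi>\<^sub>M i\<in>U. M. V (a l) (\<omega> m) = W (a l) (\<omega> m)" if "l \<in> {1..k}" "m \<in> U" for l m
    using a that prob_space_axioms by (intro AE_PiM_component[where P = "\<lambda>y. V (a l) y = W (a l) y"] AE_V) auto
  have space: "AE \<omega> in \<Pi>\<^sub>M i\<in>U. M. \<forall>l\<in>U. \<omega> l \<in> space M"
    using AE_space by eventually_elim (auto simp: space_PiM)
  consider "i \<in> {1..k}" "j \<in> {1..k}" | "i \<in> {1..k}" "j \<in> U" "j \<notin> {1..k}"
    | "i \<in> U" "i \<notin> {1..k}" "j \<in> {1..k}" | "i \<in> U" "i \<notin> {1..k}" "j \<in> U" "j \<notin> {1..k}"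
    using ij by auto
  then show ?thesis
  proof cases
    case 1
    then show ?thesis by (simp add: edge_factor_def)
  next
    case 2
    from root[OF 2(1,2)] show ?thesis
      by eventually_elim (use 2 in \<open>auto simp: edge_factor_def\<close>)
  next
    case 3
    from root[OF 3(3,1)] space show ?thesis
    proof eventually_elim
      case (elim \<omega>)
      then have "W (\<omega> i) (a j) = W (a j) (\<omega> i)" using 3 a by (intro symmetric) auto
      then show ?case using 3 elim by (simp del: atLeastAtMost_iff add: edge_factor_def)
    qed
  next
    case 4
    have "AE \<omega> in \<Pi>\<^sub>M i\<in>U. M. (\<lambda>(x, y). V x y = W x y) (\<omega> i, \<omega> j)"
      by (rule AE_PiM_pair[OF prob_space_axioms U(1) 4(1,3) ij(3) AE_V_pair])
    then show ?thesis
      by eventually_elim (use 4 in \<open>auto simp: edge_factor_def\<close>)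
  qed
qed

lemma labeled_density_eq:
  assumes G: "labeled_simple_graph k N E" and a: "a \<in> {1..k} \<rightarrow> space M"
  shows "labeled_density M W k a N E =
    (\<integral>\<omega>. (\<Prod>e\<in>{(i, j). i < j \<and> {i, j} \<in> E}. edge_factor W V k a e \<omega>) \<partial>(\<Pi>\<^sub>M i\<in>N - {1..k}. M))"
  unfolding labeled_density_def Let_def
proof (rule integral_completion_cong_AE)
  let ?U = "N - {1..k}" and ?E = "{(i, j). i < j \<and> {i, j} \<in> E}"
  have N: "finite N" "{1..k} \<subseteq> N" and E: "\<And>i j. (i, j) \<in> ?E \<Longrightarrow> i \<in> N \<and> j \<in> N \<and> i \<noteq> j"
    using G by (fastforce simp: labeled_simple_graph_def doubleton_eq_iff)+
  have fin: "finite ?E"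
    by (rule finite_subset[of _ "N \<times> N"]) (use N E in auto)
  have nodes: "i \<in> {1..k} \<union> ?U" "j \<in> {1..k} \<union> ?U" "i \<noteq> j" if "(i, j) \<in> ?E" for i j
    using E[OF that] by auto
  show "(\<lambda>\<omega>. \<Prod>e\<in>?E. edge_factor W V k a e \<omega>) \<in> borel_measurable (\<Pi>\<^sub>M i\<in>?U. M)"
  proof (rule borel_measurable_prod)
    fix e assume e: "e \<in> ?E"
    then obtain i j where ij: "e = (i, j)" "(i, j) \<in> ?E" by (metis surj_pair)
    show "edge_factor W V k a e \<in> borel_measurable (\<Pi>\<^sub>M i\<in>?U. M)"
      unfolding ij(1) by (rule measurable_edge_factor[OF a nodes(1,2)[OF ij(2)]])
  qed
  have "AE \<omega> in \<Pi>\<^sub>M i\<in>?U. M. \<forall>e\<in>?E. case e of (i, j) \<Rightarrow>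
      W (if i \<in> {1..k} then a i else \<omega> i) (if j \<in> {1..k} then a j else \<omega> j) = edge_factor W V k a (i, j) \<omega>"
  proof (rule AE_finite_allI[OF fin])
    fix e assume "e \<in> ?E"
    then obtain i j where ij: "e = (i, j)" "(i, j) \<in> ?E" by (metis surj_pair)
    show "AE \<omega> in \<Pi>\<^sub>M i\<in>?U. M. case e of (i, j) \<Rightarrow>
      W (if i \<in> {1..k} then a i else \<omega> i) (if j \<in> {1..k} then a j else \<omega> j) = edge_factor W V k a (i, j) \<omega>"
      unfolding ij(1) prod.case using N by (intro AE_edge_factor[OF a nodes[OF ij(2)]]) auto
  qed
  then show "AE \<omega> in \<Pi>\<^sub>M i\<in>?U. M.
      (\<Prod>(i, j)\<in>?E. W (if i \<in> {1..k} then a i else \<omega> i) (if j \<in> {1..k} then a j else \<omega> j)) =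
      (\<Prod>e\<in>?E. edge_factor W V k a e \<omega>)"
    by eventually_elim (rule prod.cong, auto)
qed

text \<open>Edges are directed upwards and never join two roots, so a root is always the smaller end
  and thus the first argument of \<open>V\<close>; no factor with \<open>W\<close> remains.\<close>

lemma labeled_density_rooted:
  assumes G: "rooted_graph k U E" and a: "a \<in> {1..k} \<rightarrow> space M" and p: "\<And>i. i \<in> {1..k} \<Longrightarrow> p i = a i"
  shows "labeled_simple_graph k ({1..k} \<union> U) {{i, j} | i j. (i, j) \<in> E}"
    and "labeled_density M W k a ({1..k} \<union> U) {{i, j} | i j. (i, j) \<in> E} = rooted_density M V U E p"
proof -
  let ?E = "{{i, j} | i j. (i, j) \<in> E}"
  show G': "labeled_simple_graph k ({1..k} \<union> U) ?E"
    using G by (fastforce simp: labeled_simple_graph_def rooted_graph_def)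
  have E: "{(i, j). i < j \<and> {i, j} \<in> ?E} = E"
    using G by (auto simp: rooted_graph_def doubleton_eq_iff)
  have U: "({1..k} \<union> U) - {1..k} = U"
    using G by (auto simp: rooted_graph_def)
  show "labeled_density M W k a ({1..k} \<union> U) ?E = rooted_density M V U E p"
    unfolding labeled_density_eq[OF G' a] E U rooted_density_def edge_weight_def
  proof (intro Bochner_Integration.integral_cong refl prod.cong)
    fix \<omega> e assume "e \<in> E"
    then obtain i j where ij: "e = (i, j)" "(i, j) \<in> E" by (metis surj_pair)
    with G have "j \<in> U" "j \<notin> {1..k}" "i \<in> {1..k} \<longleftrightarrow> i \<notin> U"
      by (auto simp: rooted_graph_def)
    then show "edge_factor W V k a e \<omega> =
        (case e of (i, j) \<Rightarrow> V (if i \<in> U then \<omega> i else p i) (if j \<in> U then \<omega> j else p j))"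
      using p[of i] by (simp del: atLeastAtMost_iff add: ij(1) edge_factor_def)
  qed
qed

text \<open>There are no free nodes, so nothing is averaged. This recovers the values at pairs of
  roots, which rooted graphs never see.\<close>

lemma labeled_density_edge:
  assumes ij: "i \<in> {1..k}" "j \<in> {1..k}" "i < j" and a: "a \<in> {1..k} \<rightarrow> space M"
  shows "labeled_simple_graph k {1..k} {{i, j}}"
    and "labeled_density M W k a {1..k} {{i, j}} = W (a i) (a j)"
proof -
  show G: "labeled_simple_graph k {1..k} {{i, j}}"
  proof -
    have "{i, j} \<in> {{i', j'} | i' j'. i' \<in> {1..k} \<and> j' \<in> {1..k} \<and> i' \<noteq> j'}"
      using ij by (intro CollectI exI[of _ i] exI[of _ j]) simp_all
    then show ?thesis by (simp del: atLeastAtMost_iff add: labeled_simple_graph_def)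
  qed
  have E: "{(i', j'). i' < j' \<and> {i', j'} \<in> {{i, j}}} = {(i, j)}"
    using ij by (auto simp: doubleton_eq_iff)
  interpret P: prob_space "\<Pi>\<^sub>M i\<in>({}::nat set). M" by (rule prob_space_PiM) (rule prob_space_axioms)
  show "labeled_density M W k a {1..k} {{i, j}} = W (a i) (a j)"
    unfolding labeled_density_eq[OF G a] E using ij by (simp add: edge_factor_def P.prob_space)
qed

end

section \<open>Matched sequences of roots\<close>

lemma AE_pair_pullback:
  assumes "sigma_finite_measure M2" and \<phi>: "\<phi> \<in> measurable M1 M2" "distr M1 M2 \<phi> = M2"
    and P: "AE w in M2 \<Otimes>\<^sub>M M2. P w"
  shows "AE (x, y) in M1 \<Otimes>\<^sub>M M1. P (\<phi> x, \<phi> y)"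
proof -
  have "M2 \<Otimes>\<^sub>M M2 = distr (M1 \<Otimes>\<^sub>M M1) (M2 \<Otimes>\<^sub>M M2) (\<lambda>(x, y). (\<phi> x, \<phi> y))"
    using pair_measure_distr[OF \<phi>(1) \<phi>(1)] assms(1) by (simp add: \<phi>(2))
  from subst[where P = "\<lambda>N. AE w in N. P w", OF this P]
  have "AE w in M1 \<Otimes>\<^sub>M M1. P ((\<lambda>(x, y). (\<phi> x, \<phi> y)) w)"
    by (rule AE_distrD[rotated]) (use \<phi>(1) in measurable)
  then show ?thesis
    by (simp add: case_prod_beta)
qed

text \<open>Applying \<phi> to every free node preserves the product measure. Edges between free
  nodes need equality for almost all pairs; edges at a root need \<open>agree_at_roots\<close>,
  along the row of the root or, between two roots, at that very pair.\<close>

lemma labeled_density_invariant: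
  assumes g1: "graphon_version M1 W1 V1" and g2: "graphon_version M2 W2 V2"
    and \<phi>: "\<phi> \<in> measurable M1 M2" "distr M1 M2 \<phi> = M2"
    and pairs: "AE (x, y) in M1 \<Otimes>\<^sub>M M1. W2 (\<phi> x) (\<phi> y) = W1 x y"
    and roots: "agree_at_roots M1 W1 W2 k a1 \<phi>" "\<And>i. i \<in> {1..k} \<Longrightarrow> \<phi> (a1 i) = a2 i"
    and a1: "a1 \<in> {1..k} \<rightarrow> space M1" and a2: "a2 \<in> {1..k} \<rightarrow> space M2"
    and G: "labeled_simple_graph k N E"
  shows "labeled_density M1 W1 k a1 N E = labeled_density M2 W2 k a2 N E"
proof -
  interpret g1: graphon_version M1 W1 V1 by fact
  interpret g2: graphon_version M2 W2 V2 by fact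
  let ?U = "N - {1..k}" and ?E = "{(i, j). i < j \<and> {i, j} \<in> E}"
  have N: "finite N" "{1..k} \<subseteq> N" and E: "\<And>i j. (i, j) \<in> ?E \<Longrightarrow> i \<in> N \<and> j \<in> N \<and> i \<noteq> j"
    using G by (fastforce simp: labeled_simple_graph_def doubleton_eq_iff)+
  have fin: "finite ?E"
    by (rule finite_subset[of _ "N \<times> N"]) (use N E in auto)
  have nodes: "i \<in> {1..k} \<union> ?U" "j \<in> {1..k} \<union> ?U" "i \<noteq> j" if "(i, j) \<in> ?E" for i j
    using E[OF that] by auto
  let ?P1 = "\<Pi>\<^sub>M i\<in>?U. M1" and ?P2 = "\<Pi>\<^sub>M i\<in>?U. M2"
  have distr: "distr ?P1 ?P2 (compose ?U \<phi>) = ?P2"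
    using distr_PiM_finite_prob_space'[of ?U "\<lambda>_. M1" "\<lambda>_. M2" \<phi>] N \<phi> g1.prob_space_axioms g2.prob_space_axioms
    by simp
  have c: "compose ?U \<phi> \<in> measurable ?P1 ?P2"
    unfolding compose_def
    by (intro measurable_restrict measurable_compose[OF _ \<phi>(1)] measurable_component_singleton)
  have meas1: "(\<lambda>\<omega>. \<Prod>e\<in>?E. edge_factor W1 V1 k a1 e \<omega>) \<in> borel_measurable ?P1"
  proof (rule borel_measurable_prod)
    fix e assume "e \<in> ?E"
    then obtain i j where ij: "e = (i, j)" "(i, j) \<in> ?E" by (metis surj_pair)
    show "edge_factor W1 V1 k a1 e \<in> borel_measurable ?P1"
      unfolding ij(1) by (rule g1.measurable_edge_factor[OF a1 nodes(1,2)[OF ij(2)]])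
  qed
  have meas2: "(\<lambda>\<omega>. \<Prod>e\<in>?E. edge_factor W2 V2 k a2 e \<omega>) \<in> borel_measurable ?P2"
  proof (rule borel_measurable_prod)
    fix e assume "e \<in> ?E"
    then obtain i j where ij: "e = (i, j)" "(i, j) \<in> ?E" by (metis surj_pair)
    show "edge_factor W2 V2 k a2 e \<in> borel_measurable ?P2"
      unfolding ij(1) by (rule g2.measurable_edge_factor[OF a2 nodes(1,2)[OF ij(2)]])
  qed
  have row: "AE y in M1. V2 (a2 l) (\<phi> y) = V1 (a1 l) y" if l: "l \<in> {1..k}" for l
  proof -
    have sp: "a1 l \<in> space M1" "a2 l \<in> space M2" using l a1 a2 by auto
    have "AE y in distr M1 M2 \<phi>. V2 (a2 l) y = W2 (a2 l) y"
      unfolding \<phi>(2) by (rule g2.AE_V[OF sp(2)])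
    then have "AE y in M1. V2 (a2 l) (\<phi> y) = W2 (a2 l) (\<phi> y)"
      by (rule AE_distrD[OF \<phi>(1)])
    moreover have "AE y in M1. W2 (a2 l) (\<phi> y) = W1 (a1 l) y"
      using roots(1) roots(2)[OF l] l unfolding agree_at_roots_def by metis
    ultimately show ?thesis
      using g1.AE_V[OF sp(1)] by eventually_elim simp
  qed
  have "AE (x, y) in M1 \<Otimes>\<^sub>M M1. (\<lambda>(x, y). V2 x y = W2 x y) (\<phi> x, \<phi> y)"
    using g2.sigma_finite_measure_axioms \<phi> g2.AE_V_pair
    by (rule AE_pair_pullback)
  with pairs g1.AE_V_pair
  have pair: "AE w in M1 \<Otimes>\<^sub>M M1. (\<lambda>(x, y). V2 (\<phi> x) (\<phi> y) = V1 x y) w"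
    by eventually_elim auto
  have edge: "AE \<omega> in ?P1. edge_factor W2 V2 k a2 (i, j) (compose ?U \<phi> \<omega>) = edge_factor W1 V1 k a1 (i, j) \<omega>"
    if ij: "(i, j) \<in> ?E" for i j
  proof -
    have root: "AE \<omega> in ?P1. V2 (a2 l) (\<phi> (\<omega> m)) = V1 (a1 l) (\<omega> m)" if "l \<in> {1..k}" "m \<in> ?U" for l m
      using that g1.prob_space_axioms
      by (intro AE_PiM_component[where P = "\<lambda>y. V2 (a2 l) (\<phi> y) = V1 (a1 l) y"] row) auto
    consider "i \<in> {1..k}" "j \<in> {1..k}" | "i \<in> {1..k}" "j \<in> ?U" "j \<notin> {1..k}"
      | "i \<in> ?U" "i \<notin> {1..k}" "j \<in> {1..k}" | "i \<in> ?U" "i \<notin> {1..k}" "j \<in> ?U" "j \<notin> {1..k}"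
      using nodes[OF ij] by auto
    then show ?thesis
    proof cases
      case 1
      then have "W2 (\<phi> (a1 i)) (\<phi> (a1 j)) = W1 (a1 i) (a1 j)"
        using roots(1) nodes(3)[OF ij] by (simp del: atLeastAtMost_iff add: agree_at_roots_def)
      then show ?thesis using 1 roots(2)[OF 1(1)] roots(2)[OF 1(2)]
        by (simp del: atLeastAtMost_iff add: edge_factor_def)
    next
      case 2
      from root[OF 2(1,2)] show ?thesis
        by eventually_elim (use 2 in \<open>simp del: atLeastAtMost_iff Diff_iff add: edge_factor_def compose_def\<close>)
    next
      case 3
      from root[OF 3(3,1)] show ?thesis
        by eventually_elim (use 3 in \<open>simp del: atLeastAtMost_iff Diff_iff add: edge_factor_def compose_def\<close>)
    next
      case 4
      have "AE \<omega> in ?P1. (\<lambda>(x, y). V2 (\<phi> x) (\<phi> y) = V1 x y) (\<omega> i, \<omega> j)"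
        by (rule AE_PiM_pair[OF g1.prob_space_axioms _ 4(1,3) nodes(3)[OF ij] pair]) (use N in simp)
      then show ?thesis
        by eventually_elim (use 4 in \<open>simp del: atLeastAtMost_iff Diff_iff add: edge_factor_def compose_def\<close>)
    qed
  qed
  have "AE \<omega> in ?P1. \<forall>e\<in>?E. edge_factor W2 V2 k a2 e (compose ?U \<phi> \<omega>) = edge_factor W1 V1 k a1 e \<omega>"
  proof (rule AE_finite_allI[OF fin])
    fix e assume "e \<in> ?E"
    then obtain i j where ij: "e = (i, j)" "(i, j) \<in> ?E" by (metis surj_pair)
    show "AE \<omega> in ?P1. edge_factor W2 V2 k a2 e (compose ?U \<phi> \<omega>) = edge_factor W1 V1 k a1 e \<omega>"
      unfolding ij(1) by (rule edge[OF ij(2)])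
  qed
  then have ae: "AE \<omega> in ?P1. (\<Prod>e\<in>?E. edge_factor W2 V2 k a2 e (compose ?U \<phi> \<omega>)) =
      (\<Prod>e\<in>?E. edge_factor W1 V1 k a1 e \<omega>)"
    by eventually_elim (rule prod.cong, auto)
  have "labeled_density M2 W2 k a2 N E = (\<integral>\<omega>. (\<Prod>e\<in>?E. edge_factor W2 V2 k a2 e \<omega>) \<partial>distr ?P1 ?P2 (compose ?U \<phi>))"
    unfolding distr by (rule g2.labeled_density_eq[OF G a2])
  also have "\<dots> = (\<integral>\<omega>. (\<Prod>e\<in>?E. edge_factor W2 V2 k a2 e (compose ?U \<phi> \<omega>)) \<partial>?P1)"
    by (rule integral_distr[OF c meas2])
  also have "\<dots> = (\<integral>\<omega>. (\<Prod>e\<in>?E. edge_factor W1 V1 k a1 e \<omega>) \<partial>?P1)"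
    using measurable_compose[OF c meas2] meas1 ae by (rule integral_cong_AE)
  also have "\<dots> = labeled_density M1 W1 k a1 N E"
    by (rule g1.labeled_density_eq[OF G a1, symmetric])
  finally show ?thesis ..
qed

text \<open>Every neighbourhood contains balls of arbitrarily late index, which makes all tails of
  the sequences below dense.\<close>

lemma (in pure_graphon) dense_small_balls:
  "\<exists>B :: nat \<Rightarrow> 'a set. (\<forall>m. B m \<in> sets M \<and> emeasure M (B m) > 0) \<and>
    (\<forall>x\<in>space M. \<forall>e>0. \<forall>N. \<exists>m\<ge>N. B m \<subseteq> mball x e)"
proof -
  obtain d :: "nat \<Rightarrow> 'a" where d: "range d \<subseteq> space M" "\<forall>x\<in>space M. \<forall>e>0. \<exists>n. r x (d n) < e"
    using dense_sequence by blast
  define B where "B m = (case prod_decode m of (i, j) \<Rightarrow> mball (d i) (1 / real (Suc j)))" for m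
  have "\<exists>m\<ge>N. B m \<subseteq> mball x e" if x: "x \<in> space M" and e: "e > 0" for x e N
  proof -
    obtain i where i: "r x (d i) < e / 2" using d(2) x e half_gt_zero by blast
    obtain j0 where j0: "1 / real (Suc j0) < e / 2" using nat_approx_posE[of "e / 2"] e by auto
    \<comment> \<open>Any larger \<open>j\<close> gives a smaller ball, and \<open>j >= N\<close>
      pushes the code \<open>prod_encode (i, j)\<close> beyond \<open>N\<close>.\<close>
    define j where "j = max N j0"
    have "1 / real (Suc j) \<le> 1 / real (Suc j0)" by (simp add: j_def frac_le)
    with j0 have j: "1 / real (Suc j) < e / 2" by linarith
    have "B (prod_encode (i, j)) \<subseteq> mball x e"
    proof
      fix y assume "y \<in> B (prod_encode (i, j))"
      then have y: "y \<in> space M" "r (d i) y < 1 / real (Suc j)" by (auto simp: B_def)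
      have "d i \<in> space M" using d(1) by auto
      then have "r x y < e" using triangle[OF x \<open>d i \<in> space M\<close> y(1)] i j y(2) by linarith
      then show "y \<in> mball x e" using x y by simp
    qed
    moreover have "prod_encode (i, j) \<ge> N"
      using le_prod_encode_2[of j i] by (simp add: j_def)
    ultimately show ?thesis by blast
  qed
  moreover have "B m \<in> sets M \<and> emeasure M (B m) > 0" for m
    using d(1) by (auto simp: B_def split: prod.split intro!: sets_open measure_ball_pos)
  ultimately show ?thesis by blast
qed

text \<open>Roots are numbered from 1, so \<open>X 0\<close> and \<open>Y 0\<close> are mere
  padding. The assumptions are symmetric in the two graphons, and each result can be reused with the
  sides exchanged.\<close>

locale matched_sequences = g1: graphon_version M1 W1 V1 + g2: graphon_version M2 W2 V2
  for M1 :: "'a measure" and W1 V1 and M2 :: "'b measure" and W2 V2 +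
  fixes k :: nat and X :: "nat \<Rightarrow> 'a" and Y :: "nat \<Rightarrow> 'b"
  assumes X: "X i \<in> space M1" and Y: "Y i \<in> space M2"
    and same: "n \<ge> k \<Longrightarrow> same_densities M1 V1 M2 V2 n X Y"
    and dense_X: "x \<in> space M1 \<Longrightarrow> e > 0 \<Longrightarrow> \<exists>n\<ge>N. graphon_dist M1 W1 x (X n) < e"
    and dense_Y: "y \<in> space M2 \<Longrightarrow> e > 0 \<Longrightarrow> \<exists>n\<ge>N. graphon_dist M2 W2 y (Y n) < e"

lemma matched_sequences_commute:
  assumes "matched_sequences M1 W1 V1 M2 W2 V2 k X Y"
  shows "matched_sequences M2 W2 V2 M1 W1 V1 k Y X"
proof -
  interpret matched_sequences M1 W1 V1 M2 W2 V2 k X Y by fact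
  show ?thesis
    using X Y same same_densities_commute dense_X dense_Y by unfold_locales blast+
qed

lemma matched_sequences_exist:
  assumes g1: "graphon_version M1 W1 V1" and g2: "graphon_version M2 W2 V2"
    and p: "\<And>i. p i \<in> space M1" and q: "\<And>i. q i \<in> space M2"
    and same: "same_densities M1 V1 M2 V2 k p q"
  shows "\<exists>X Y. matched_sequences M1 W1 V1 M2 W2 V2 k X Y \<and> (\<forall>i\<in>{1..k}. X i = p i \<and> Y i = q i)"
proof -
  interpret g1: graphon_version M1 W1 V1 by fact
  interpret g2: graphon_version M2 W2 V2 by fact
  obtain B1 :: "nat \<Rightarrow> 'a set" where B1: "\<And>m. B1 m \<in> sets M1 \<and> emeasure M1 (B1 m) > 0"
    "\<forall>x\<in>space M1. \<forall>e>0. \<forall>N. \<exists>m\<ge>N. B1 m \<subseteq> g1.mball x e"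
    using g1.dense_small_balls by blast
  obtain B2 :: "nat \<Rightarrow> 'b set" where B2: "\<And>m. B2 m \<in> sets M2 \<and> emeasure M2 (B2 m) > 0"
    "\<forall>x\<in>space M2. \<forall>e>0. \<forall>N. \<exists>m\<ge>N. B2 m \<subseteq> g2.mball x e"
    using g2.dense_small_balls by blast
  \<comment> \<open>Stage \<open>n\<close> has \<open>k + n\<close> matched roots; later entries of
    the two sequences are still padding.\<close>
  define P where "P n s \<longleftrightarrow> (\<forall>i. fst s i \<in> space M1) \<and> (\<forall>i. snd s i \<in> space M2) \<and>
    same_densities M1 V1 M2 V2 (k + n) (fst s) (snd s) \<and> (n = 0 \<longrightarrow> s = (p, q))"
    for n and s :: "(nat \<Rightarrow> 'a) \<times> (nat \<Rightarrow> 'b)"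
  \<comment> \<open>Even stages place a root in the next ball of the first graphon, odd stages in
    that of the second; \<open>n div 2\<close> runs through all balls on either side.\<close>
  define Q where "Q n s t \<longleftrightarrow> (\<exists>x y. t = ((fst s)(Suc (k + n) := x), (snd s)(Suc (k + n) := y)) \<and>
    (if even n then x \<in> B1 (n div 2) else y \<in> B2 (n div 2)))"
    for n and s t :: "(nat \<Rightarrow> 'a) \<times> (nat \<Rightarrow> 'b)"
  have "\<exists>t. P (Suc n) t \<and> Q n s t" if s: "P n s" for n s
  proof -
    have s': "\<And>i. fst s i \<in> space M1" "\<And>i. snd s i \<in> space M2"
      "same_densities M1 V1 M2 V2 (k + n) (fst s) (snd s)" using s by (auto simp: P_def)
    obtain x y where xy: "x \<in> space M1" "y \<in> space M2"
      "same_densities M1 V1 M2 V2 (Suc (k + n)) ((fst s)(Suc (k + n) := x)) ((snd s)(Suc (k + n) := y))"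
      "if even n then x \<in> B1 (n div 2) else y \<in> B2 (n div 2)"
    proof (cases "even n")
      case True
      have "\<exists>x\<in>B1 (n div 2). \<exists>y\<in>space M2. same_densities M1 V1 M2 V2 (Suc (k + n)) ((fst s)(Suc (k + n) := x)) ((snd s)(Suc (k + n) := y))"
        using B1(1) by (intro same_densities_extend[OF g1.measurable_kernel_axioms g2.measurable_kernel_axioms g1.standard g2.standard s']) auto
      then obtain x y where xy: "x \<in> B1 (n div 2)" "y \<in> space M2"
        "same_densities M1 V1 M2 V2 (Suc (k + n)) ((fst s)(Suc (k + n) := x)) ((snd s)(Suc (k + n) := y))" by blast
      moreover have "x \<in> space M1"
        using xy(1) B1(1) sets.sets_into_space by blast
      ultimately show ?thesis using True by (intro that[of x y]) simp_all
    next
      case False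
      have "\<exists>y\<in>B2 (n div 2). \<exists>x\<in>space M1. same_densities M2 V2 M1 V1 (Suc (k + n)) ((snd s)(Suc (k + n) := y)) ((fst s)(Suc (k + n) := x))"
        using B2(1) s'(3)[unfolded same_densities_commute[of M1]]
        by (intro same_densities_extend[OF g2.measurable_kernel_axioms g1.measurable_kernel_axioms g2.standard g1.standard s'(2,1)]) auto
      then obtain x y where xy: "y \<in> B2 (n div 2)" "x \<in> space M1"
        "same_densities M2 V2 M1 V1 (Suc (k + n)) ((snd s)(Suc (k + n) := y)) ((fst s)(Suc (k + n) := x))" by blast
      moreover have "y \<in> space M2"
        using xy(1) B2(1) sets.sets_into_space by blast
      moreover have "same_densities M1 V1 M2 V2 (Suc (k + n)) ((fst s)(Suc (k + n) := x)) ((snd s)(Suc (k + n) := y))"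
        using xy(3) same_densities_commute by blast
      ultimately show ?thesis using False by (intro that[of x y]) simp_all
    qed
    let ?t = "((fst s)(Suc (k + n) := x), (snd s)(Suc (k + n) := y))"
    have "P (Suc n) ?t" using s' xy by (simp add: P_def)
    moreover have "Q n s ?t" using xy(4) unfolding Q_def by blast
    ultimately show ?thesis by blast
  qed
  moreover have "P 0 (p, q)" using p q same by (simp add: P_def)
  ultimately obtain f where f: "\<And>n. P n (f n)" "\<And>n. Q n (f n) (f (Suc n))"
    using dependent_nat_choice[of P Q] by metis
  \<comment> \<open>Entry \<open>i\<close> never changes once \<open>k + n >= i\<close>, so stage
    \<open>i\<close> already shows its final value.\<close>
  define X where "X i = fst (f i) i" for i
  define Y where "Y i = snd (f i) i" for i
  have stable: "fst (f (n + d)) i = fst (f n) i \<and> snd (f (n + d)) i = snd (f n) i" if "i \<le> k + n" for n d i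
  proof (induction d)
    case (Suc d)
    have "i \<noteq> Suc (k + (n + d))" using that by simp
    then show ?case using f(2)[of "n + d"] Suc by (auto simp: Q_def)
  qed simp
  have XY: "fst (f n) i = X i" "snd (f n) i = Y i" if "i \<le> k + n" for n i
    using stable[of i n i] stable[of i i n] that by (auto simp: X_def Y_def add.commute)
  have sp: "X i \<in> space M1" "Y i \<in> space M2" for i
    using f(1)[of i] by (auto simp: X_def Y_def P_def)
  have "same_densities M1 V1 M2 V2 n X Y" if nk: "n \<ge> k" for n
    unfolding same_densities_def
  proof (intro allI impI)
    fix U E assume G: "rooted_graph n U E"
    obtain m where m: "n = k + m" using le_Suc_ex[OF nk] by blast
    have "rooted_density M1 V1 U E X = rooted_density M1 V1 U E (fst (f m))"
      by (rule rooted_density_cong[OF G]) (use XY m in auto)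
    also have "\<dots> = rooted_density M2 V2 U E (snd (f m))"
      using f(1)[of m] G m by (simp add: P_def same_densities_def)
    also have "\<dots> = rooted_density M2 V2 U E Y"
      by (rule rooted_density_cong[OF G]) (use XY m in auto)
    finally show "rooted_density M1 V1 U E X = rooted_density M2 V2 U E Y" .
  qed
  moreover have "X (Suc (k + 2 * m)) \<in> B1 m" for m
    using f(2)[of "2 * m"] XY(1)[of "Suc (k + 2 * m)" "Suc (2 * m)"] by (auto simp: Q_def)
  then have "\<exists>n\<ge>N. g1.r x (X n) < e" if "x \<in> space M1" "e > 0" for x e N
  proof -
    obtain m where "m \<ge> N" "B1 m \<subseteq> g1.mball x e" using B1(2) \<open>x \<in> space M1\<close> \<open>e > 0\<close> by blast
    then have "g1.r x (X (Suc (k + 2 * m))) < e" "Suc (k + 2 * m) \<ge> N"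
      using \<open>X (Suc (k + 2 * m)) \<in> B1 m\<close> by auto
    then show ?thesis by blast
  qed
  moreover have "Y (Suc (k + Suc (2 * m))) \<in> B2 m" for m
    using f(2)[of "Suc (2 * m)"] XY(2)[of "Suc (k + Suc (2 * m))" "Suc (Suc (2 * m))"] by (auto simp: Q_def)
  then have "\<exists>n\<ge>N. g2.r y (Y n) < e" if "y \<in> space M2" "e > 0" for y e N
  proof -
    obtain m where "m \<ge> N" "B2 m \<subseteq> g2.mball y e" using B2(2) \<open>y \<in> space M2\<close> \<open>e > 0\<close> by blast
    then have "g2.r y (Y (Suc (k + Suc (2 * m)))) < e" "Suc (k + Suc (2 * m)) \<ge> N"
      using \<open>Y (Suc (k + Suc (2 * m))) \<in> B2 m\<close> by auto
    then show ?thesis by blast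
  qed
  ultimately have "matched_sequences M1 W1 V1 M2 W2 V2 k X Y"
    using sp by unfold_locales blast+
  moreover have "X i = p i \<and> Y i = q i" if "i \<in> {1..k}" for i
    using XY[of i 0] f(1)[of 0] that by (simp add: P_def)
  ultimately show ?thesis by blast
qed

section \<open>Codegrees as rooted densities\<close>

lemma (in measurable_kernel) rooted_density_no_nodes: "rooted_density M V {} E p = edge_weight V E p"
proof -
  interpret P: prob_space "\<Pi>\<^sub>M i\<in>({}::nat set). M" by (rule prob_space_PiM) (rule prob_space_axioms)
  show ?thesis by (simp add: rooted_density_def P.prob_space)
qed

lemma rooted_graph_path:
  "i \<in> {1..n} \<Longrightarrow> j \<in> {1..n} \<Longrightarrow> rooted_graph n {Suc n} {(i, Suc n), (j, Suc n)}"
  by (auto simp: rooted_graph_def)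

text \<open>The two-edge path from root \<open>i\<close> to the last root \<open>n\<close>; as a
  function of the last root, its density is a codegree.\<close>

definition path_code :: "nat \<Rightarrow> nat \<Rightarrow> nat list \<times> (nat \<times> nat) list" where
  "path_code n i = ([Suc n], [(i, Suc n), (n, Suc n)])"

context graphon_version
begin

lemma codegree_version:
  assumes "x \<in> space M" "y \<in> space M"
  shows "codegree x y = (\<integral>z. V x z * V y z \<partial>M)"
  unfolding codegree_def
proof (rule integral_cong_AE)
  show "AE z in M. W x z * W y z = V x z * V y z"
    using AE_V[OF assms(1)] AE_V[OF assms(2)] by eventually_elim simp
  show "(\<lambda>z. V x z * V y z) \<in> borel_measurable M"
    using assms by (intro borel_measurable_times measurable_V_compose) auto
qed (use integrable_section_mult[OF assms] in auto)

lemma rooted_density_path: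
  assumes p: "\<And>i. p i \<in> space M" and ij: "i \<in> {1..n}" "j \<in> {1..n}" "i \<noteq> j"
  shows "rooted_density M V {Suc n} {(i, Suc n), (j, Suc n)} p = codegree (p i) (p j)"
proof -
  have "rooted_density M V {Suc n} {(i, Suc n), (j, Suc n)} p =
      (\<integral>z. rooted_density M V {} {(i, Suc n), (j, Suc n)} (p(Suc n := z)) \<partial>M)"
    by (rule rooted_density_insert[OF p]) auto
  also have "\<dots> = (\<integral>z. V (p i) z * V (p j) z \<partial>M)"
    unfolding rooted_density_no_nodes edge_weight_def using ij by simp
  finally show ?thesis by (simp add: codegree_version p)
qed

lemma root_profile_path:
  assumes p: "\<And>i. p i \<in> space M" and i: "i \<in> {1..n}" and x: "x \<in> space M"
  shows "root_profile M V (Suc n) (p(Suc n := x)) (path_code (Suc n) i) = codegree (p i) x"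
proof -
  let ?p = "p(Suc n := x)"
  have ij: "i \<in> {1..Suc n}" "Suc n \<in> {1..Suc n}" "i \<noteq> Suc n" using i by auto
  have "rooted_graph_of (Suc n) (path_code (Suc n) i) = ({Suc (Suc n)}, {(i, Suc (Suc n)), (Suc n, Suc (Suc n))})"
    using rooted_graph_path[OF ij(1,2)] by (simp add: rooted_graph_of_def path_code_def)
  then have "root_profile M V (Suc n) ?p (path_code (Suc n) i) = codegree (?p i) (?p (Suc n))"
    unfolding root_profile_def using rooted_density_path[of ?p, OF _ ij] p x by simp
  then show ?thesis using ij by simp
qed

lemma measurable_codegree: "x \<in> space M \<Longrightarrow> codegree x \<in> borel_measurable M"
proof -
  assume x: "x \<in> space M"
  have "(\<lambda>y. codegree x y) \<in> borel_measurable M \<longleftrightarrow>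
      (\<lambda>y. root_profile M V (Suc 1) ((\<lambda>_. x)(Suc 1 := y)) (path_code (Suc 1) 1)) \<in> borel_measurable M"
    using x by (intro measurable_cong) (simp add: root_profile_path)
  then show "codegree x \<in> borel_measurable M"
    using measurable_rooted_density[of "\<lambda>_. x"] x unfolding root_profile_def by simp
qed

lemma codegree_unit_interval:
  assumes "x \<in> space M" "y \<in> space M"
  shows "codegree x y \<in> {0..1}"
proof -
  have "codegree x y \<le> 1"
    unfolding codegree_def using assms range_W
    by (intro integral_le_const integrable_section_mult AE_I2) (auto intro!: mult_le_one)
  moreover have "codegree x y \<ge> 0"
    unfolding codegree_def using assms range_W
    by (intro Bochner_Integration.integral_nonneg mult_nonneg_nonneg) auto
  ultimately show ?thesis by simp
qed

end

section \<open>The induced isomorphism\<close>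

text \<open>The index starts at \<open>Suc i\<close> because \<open>X 0\<close> is not a
  root.\<close>

definition (in pure_graphon) codegree_profile :: "(nat \<Rightarrow> 'a) \<Rightarrow> 'a \<Rightarrow> nat \<Rightarrow> real" where
  "codegree_profile X x i = codegree (X (Suc i)) x"

context matched_sequences
begin

abbreviation "c1 \<equiv> g1.codegree"
abbreviation "c2 \<equiv> g2.codegree"
abbreviation "r1 \<equiv> g1.r"
abbreviation "r2 \<equiv> g2.r"

lemma codegree_eq:
  assumes "i \<ge> 1" "j \<ge> 1" "i \<noteq> j"
  shows "c1 (X i) (X j) = c2 (Y i) (Y j)"
proof -
  define n where "n = k + i + j"
  have ij: "i \<in> {1..n}" "j \<in> {1..n}" using assms by (auto simp: n_def)
  have "same_densities M1 V1 M2 V2 n X Y" by (rule same) (simp add: n_def)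
  then have "rooted_density M1 V1 {Suc n} {(i, Suc n), (j, Suc n)} X = rooted_density M2 V2 {Suc n} {(i, Suc n), (j, Suc n)} Y"
    using rooted_graph_path[OF ij] by (simp add: same_densities_def)
  then show ?thesis
    using g1.rooted_density_path[OF X ij assms(3)] g2.rooted_density_path[OF Y ij assms(3)] by simp
qed

text \<open>On the second side it suffices to test codegrees at the dense points \<open>Y m\<close>
  with \<open>m > i + j\<close>. There they equal codegrees on the first side, which are Lipschitz
  for \<open>r1\<close>. Distinctness of \<open>i\<close> and \<open>j\<close> is avoided in this
  way.\<close>

lemma dist_transfer:
  assumes ij: "i \<ge> 1" "j \<ge> 1"
  shows "(r2 (Y i) (Y j))\<^sup>2 \<le> 2 * r1 (X i) (X j)"
proof (rule g2.dist_le_codegree[OF Y Y])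
  fix v assume v: "v \<in> space M2"
  have "\<bar>c2 (Y i) v - c2 (Y j) v\<bar> \<le> r1 (X i) (X j) + e" if e: "e > 0" for e
  proof -
    obtain m where m: "m \<ge> Suc (i + j)" "r2 v (Y m) < e / 2"
      using dense_Y[OF v, of "e / 2" "Suc (i + j)"] e by auto
    have close: "\<bar>c2 (Y l) v - c2 (Y l) (Y m)\<bar> < e / 2" for l
      using g2.codegree_lipschitz[OF v Y[of m] Y[of l]] m(2) by (simp add: g2.codegree_commute)
    have "\<bar>c1 (X i) (X m) - c1 (X j) (X m)\<bar> \<le> r1 (X i) (X j)"
      by (rule g1.codegree_lipschitz[OF X X X])
    moreover have "c1 (X i) (X m) = c2 (Y i) (Y m)" "c1 (X j) (X m) = c2 (Y j) (Y m)"
      using ij m(1) by (auto intro!: codegree_eq)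
    ultimately show ?thesis using close[of i] close[of j] by linarith
  qed
  then show "\<bar>c2 (Y i) v - c2 (Y j) v\<bar> \<le> r1 (X i) (X j)"
    by (rule field_le_epsilon)
qed

text \<open>
  The indices are kept away from any given \<open>i\<close> because diagonal codegrees \<open>c1 (X i) (X i)\<close> are
  not densities of simple graphs; they are recovered as limits only.
\<close>
definition approximates :: "(nat \<Rightarrow> nat) \<Rightarrow> 'a \<Rightarrow> 'b \<Rightarrow> bool" where
  "approximates s x y \<longleftrightarrow> (\<forall>l. s l > l) \<and> (\<lambda>l. r1 x (X (s l))) \<longlonglongrightarrow> 0 \<and> (\<lambda>l. r2 y (Y (s l))) \<longlonglongrightarrow> 0"

lemma approximates_exist:
  assumes x: "x \<in> space M1"
  shows "\<exists>y\<in>space M2. \<exists>s. approximates s x y"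
proof -
  have "\<forall>l. \<exists>n. n \<ge> Suc l \<and> r1 x (X n) < 1 / real (Suc l)"
    using dense_X[OF x] by (metis of_nat_0_less_iff zero_less_Suc zero_less_divide_1_iff)
  from choice[OF this] obtain s where s: "\<And>l. s l > l" "\<And>l. r1 x (X (s l)) < 1 / real (Suc l)"
    by (auto simp: Suc_le_eq)
  have lim1: "(\<lambda>l. r1 x (X (s l))) \<longlonglongrightarrow> 0"
  proof (rule tendsto_sandwich[OF _ _ tendsto_const LIMSEQ_inverse_real_of_nat])
    show "\<forall>\<^sub>F l in sequentially. r1 x (X (s l)) \<le> inverse (real (Suc l))"
      using s(2) by (intro always_eventually allI less_imp_le) (simp add: inverse_eq_divide)
  qed simp
  have "g2.MCauchy (\<lambda>l. Y (s l))"
    unfolding g2.MCauchy_def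
  proof (intro conjI allI impI)
    show "range (\<lambda>l. Y (s l)) \<subseteq> space M2" using Y by auto
    fix e :: real assume e: "e > 0"
    \<comment> \<open>\<open>dist_transfer\<close> bounds the squared distance by twice an
      \<open>r1\<close>-distance, and the triangle inequality adds two errors: hence a quarter of
      the square.\<close>
    then have "e\<^sup>2 / 4 > 0" by simp
    then obtain N where N: "1 / real (Suc N) < e\<^sup>2 / 4" using nat_approx_posE by blast
    have small: "r1 x (X (s n)) < e\<^sup>2 / 4" if "n \<ge> N" for n
    proof -
      have "1 / real (Suc n) \<le> 1 / real (Suc N)" using that by (simp add: frac_le)
      with s(2)[of n] N show ?thesis by linarith
    qed
    have "r2 (Y (s n)) (Y (s m)) < e" if "N \<le> n" "N \<le> m" for n m
    proof -
      have "r1 (X (s n)) (X (s m)) \<le> r1 (X (s n)) x + r1 x (X (s m))"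
        by (rule g1.triangle[OF X x X])
      also have "\<dots> < e\<^sup>2 / 2"
        using small[OF that(1)] small[OF that(2)] g1.commute[of x "X (s n)"] by simp
      finally have "2 * r1 (X (s n)) (X (s m)) < e\<^sup>2" by simp
      moreover have "(r2 (Y (s n)) (Y (s m)))\<^sup>2 \<le> 2 * r1 (X (s n)) (X (s m))"
        using s(1)[of n] s(1)[of m] by (intro dist_transfer) auto
      ultimately have "(r2 (Y (s n)) (Y (s m)))\<^sup>2 < e\<^sup>2" by linarith
      then show ?thesis by (rule power2_less_imp_less) (use e in simp)
    qed
    then show "\<exists>N. \<forall>n n'. N \<le> n \<longrightarrow> N \<le> n' \<longrightarrow> r2 (Y (s n)) (Y (s n')) < e" by blast
  qed
  then obtain y where lim: "limitin g2.mtopology (\<lambda>l. Y (s l)) y sequentially"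
    using g2.complete unfolding g2.mcomplete_def by blast
  then have y: "y \<in> space M2"
    and "\<forall>e>0. \<exists>N. \<forall>n\<ge>N. Y (s n) \<in> space M2 \<and> r2 (Y (s n)) y < e"
    unfolding g2.limit_metric_sequentially by blast+
  then have lim': "\<And>e. e > 0 \<Longrightarrow> \<exists>N. \<forall>n\<ge>N. r2 (Y (s n)) y < e"
    by meson
  have "(\<lambda>l. r2 y (Y (s l))) \<longlonglongrightarrow> 0"
  proof (rule LIMSEQ_I)
    fix e :: real assume "e > 0"
    from lim'[OF this] show "\<exists>N. \<forall>n\<ge>N. norm (r2 y (Y (s n)) - 0) < e"
      by (simp add: g2.commute[of y])
  qed
  with s(1) lim1 y show ?thesis unfolding approximates_def by blast
qed

lemma codegree_approximates:
  assumes x: "x \<in> space M1" and y: "y \<in> space M2" and s: "approximates s x y" and i: "i \<ge> 1"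
  shows "c2 (Y i) y = c1 (X i) x"
proof -
  have lim1: "(\<lambda>l. c1 (X i) (X (s l))) \<longlonglongrightarrow> c1 (X i) x"
  proof (rule Lim_null_comparison[THEN LIM_zero_cancel])
    show "\<forall>\<^sub>F l in sequentially. norm (c1 (X i) (X (s l)) - c1 (X i) x) \<le> r1 x (X (s l))"
      using g1.codegree_lipschitz[OF X x X]
      by (intro always_eventually) (simp add: g1.codegree_commute[of "X i"] g1.commute[of x])
  qed (use s in \<open>simp add: approximates_def\<close>)
  have lim2: "(\<lambda>l. c2 (Y i) (Y (s l))) \<longlonglongrightarrow> c2 (Y i) y"
  proof (rule Lim_null_comparison[THEN LIM_zero_cancel])
    show "\<forall>\<^sub>F l in sequentially. norm (c2 (Y i) (Y (s l)) - c2 (Y i) y) \<le> r2 y (Y (s l))"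
      using g2.codegree_lipschitz[OF Y y Y]
      by (intro always_eventually) (simp add: g2.codegree_commute[of "Y i"] g2.commute[of y])
  qed (use s in \<open>simp add: approximates_def\<close>)
  have "\<forall>\<^sub>F l in sequentially. c1 (X i) (X (s l)) = c2 (Y i) (Y (s l))"
  proof (rule eventually_sequentiallyI[of i])
    fix l assume "l \<ge> i"
    moreover have "s l > l" using s by (simp add: approximates_def)
    ultimately show "c1 (X i) (X (s l)) = c2 (Y i) (Y (s l))" using i by (intro codegree_eq) auto
  qed
  from LIMSEQ_unique[OF lim2 Lim_transform_eventually[OF lim1 this]] show ?thesis .
qed

text \<open>\<open>Y (s l)\<close> tends to \<open>y\<close> by assumption and to \<open>Y i\<close>
  by \<open>dist_transfer\<close>, which compares distances to the root directly and needs no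
  diagonal codegree.\<close>

lemma approximates_root:
  assumes i: "i \<ge> 1" and y: "y \<in> space M2" and s: "approximates s (X i) y"
  shows "y = Y i"
proof -
  have sl: "s l > l" for l using s by (simp add: approximates_def)
  have "(\<lambda>l. 2 * r1 (X i) (X (s l))) \<longlonglongrightarrow> 2 * 0"
    using s by (intro tendsto_mult_left) (simp add: approximates_def)
  then have z: "(\<lambda>l. 2 * r1 (X i) (X (s l))) \<longlonglongrightarrow> 0" by simp
  have "(r2 (Y i) (Y (s l)))\<^sup>2 \<le> 2 * r1 (X i) (X (s l))" for l
    using i sl[of l] by (intro dist_transfer) auto
  then have "(\<lambda>l. (r2 (Y i) (Y (s l)))\<^sup>2) \<longlonglongrightarrow> 0"
    by (intro tendsto_sandwich[OF _ _ tendsto_const z] always_eventually) auto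
  then have "(\<lambda>l. sqrt ((r2 (Y i) (Y (s l)))\<^sup>2)) \<longlonglongrightarrow> sqrt 0"
    by (rule tendsto_real_sqrt)
  then have "(\<lambda>l. r2 y (Y (s l)) + r2 (Y i) (Y (s l))) \<longlonglongrightarrow> 0 + 0"
    using s by (intro tendsto_add) (auto simp: approximates_def)
  moreover have "r2 y (Y i) \<le> r2 y (Y (s l)) + r2 (Y i) (Y (s l))" for l
    using g2.triangle[OF y Y[of "s l"] Y[of i]] by (simp add: g2.commute[of "Y i"])
  ultimately have "r2 y (Y i) \<le> 0"
    by (intro LIMSEQ_le_const[where a = "r2 y (Y i)"]) auto
  then show ?thesis
    using g2.zero[OF y Y] g2.nonneg[of y "Y i"] by (metis order_antisym)
qed

section \<open>Codegree profiles and the bijection they define\<close>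

abbreviation "profile1 \<equiv> g1.codegree_profile X"
abbreviation "profile2 \<equiv> g2.codegree_profile Y"

lemma profile_approximates:
  "x \<in> space M1 \<Longrightarrow> y \<in> space M2 \<Longrightarrow> approximates s x y \<Longrightarrow> profile2 y = profile1 x"
  unfolding g1.codegree_profile_def g2.codegree_profile_def by (intro ext codegree_approximates) auto

text \<open>Codegrees with a dense sequence determine those with every point, by the Lipschitz
  bound; equal codegrees give distance 0.\<close>

lemma inj_profile2: "inj_on profile2 (space M2)"
proof (rule inj_onI)
  fix y y' assume y: "y \<in> space M2" "y' \<in> space M2" and eq: "profile2 y = profile2 y'"
  have "(r2 y y')\<^sup>2 \<le> 2 * 0"
  proof (rule g2.dist_le_codegree[OF y])
    fix v assume v: "v \<in> space M2"
    have "\<bar>c2 y v - c2 y' v\<bar> \<le> 0 + e" if e: "e > 0" for e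
    proof -
      obtain m where m: "m \<ge> 1" "r2 v (Y m) < e / 2"
        using dense_Y[OF v, of "e / 2" 1] e by auto
      have "c2 (Y m) y = c2 (Y m) y'"
        using fun_cong[OF eq, of "m - 1"] m(1) by (simp add: g2.codegree_profile_def)
      moreover have "\<bar>c2 v y - c2 (Y m) y\<bar> \<le> r2 v (Y m)" "\<bar>c2 v y' - c2 (Y m) y'\<bar> \<le> r2 v (Y m)"
        using g2.codegree_lipschitz[OF v Y] y by auto
      ultimately show ?thesis
        using m(2) unfolding g2.codegree_commute[of _ v] by linarith
    qed
    then show "\<bar>c2 y v - c2 y' v\<bar> \<le> 0" by (rule field_le_epsilon)
  qed
  then show "y = y'"
    using g2.zero[OF y] by simp
qed

lemma measurable_profiles: "profile1 \<in> borel_measurable M1" "profile2 \<in> borel_measurable M2"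
  unfolding g1.codegree_profile_def g2.codegree_profile_def
  by (intro measurable_coordinatewise_then_product g1.measurable_codegree g2.measurable_codegree X Y)+

lemma profiles_unit_interval:
  "x \<in> space M1 \<Longrightarrow> profile1 x i \<in> {0..1}" "y \<in> space M2 \<Longrightarrow> profile2 y i \<in> {0..1}"
  unfolding g1.codegree_profile_def g2.codegree_profile_def
  by (intro g1.codegree_unit_interval g2.codegree_unit_interval X Y; assumption)+

lemma prod_profile_codes:
  assumes n: "\<And>l. l \<in> set ls \<Longrightarrow> Suc l \<le> n"
  shows "x \<in> space M1 \<Longrightarrow> (\<Prod>l\<leftarrow>ls. profile1 x l) =
      (\<Prod>c\<leftarrow>map (\<lambda>l. path_code (Suc n) (Suc l)) ls. root_profile M1 V1 (Suc n) (X(Suc n := x)) c)"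
    and "y \<in> space M2 \<Longrightarrow> (\<Prod>l\<leftarrow>ls. profile2 y l) =
      (\<Prod>c\<leftarrow>map (\<lambda>l. path_code (Suc n) (Suc l)) ls. root_profile M2 V2 (Suc n) (Y(Suc n := y)) c)"
  unfolding map_map comp_def g1.codegree_profile_def g2.codegree_profile_def using n
  by (auto intro!: arg_cong[where f = prod_list] simp: g1.root_profile_path X g2.root_profile_path Y)

lemma moments_eq: "(\<integral>x. (\<Prod>l\<leftarrow>ls. profile1 x l) \<partial>M1) = (\<integral>y. (\<Prod>l\<leftarrow>ls. profile2 y l) \<partial>M2)"
proof -
  \<comment> \<open>Large enough for \<open>k <= n\<close> and for every root \<open>Suc l\<close>
    in use, as an entry of \<open>ls\<close> is at most the sum.\<close>
  define n where "n = k + Suc (sum_list ls)"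
  have n: "Suc l \<le> n" if "l \<in> set ls" for l
    using member_le_sum_list[OF that] by (simp add: n_def)
  have "same_densities M1 V1 M2 V2 n X Y" by (rule same) (simp add: n_def)
  note m = same_densities_moments[OF g1.measurable_kernel_axioms g2.measurable_kernel_axioms X Y this]
  show ?thesis
    using m[of "map (\<lambda>l. path_code (Suc n) (Suc l)) ls"] prod_profile_codes[OF n]
    by (simp cong: Bochner_Integration.integral_cong)
qed

text \<open>The weight is one edge from root \<open>i\<close> to the averaged node, added to the
  graph of the unweighted moment.\<close>

lemma root_moments_eq:
  assumes i: "i \<ge> 1"
  shows "(\<integral>x. V1 (X i) x * (\<Prod>l\<leftarrow>ls. profile1 x l) \<partial>M1) = (\<integral>y. V2 (Y i) y * (\<Prod>l\<leftarrow>ls. profile2 y l) \<partial>M2)"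
proof -
  define n where "n = k + i + Suc (sum_list ls)"
  have n: "Suc l \<le> n" if "l \<in> set ls" for l
    using member_le_sum_list[OF that] by (simp add: n_def)
  have i': "i \<in> {1..n}" using i by (simp add: n_def)
  define cs where "cs = map (\<lambda>l. path_code (Suc n) (Suc l)) ls"
  define U E where "U = fst (glue_list (Suc n) cs)" and "E = snd (glue_list (Suc n) cs)"
  have G: "rooted_graph (Suc n) U E"
    unfolding U_def E_def by (rule rooted_graph_glue_list)
  have 1: "(\<Prod>l\<leftarrow>ls. profile1 x l) = rooted_density M1 V1 U E (X(Suc n := x))" if x: "x \<in> space M1" for x
  proof -
    have "(X(Suc n := x)) i \<in> space M1" for i using X x by simp
    note g1.prod_root_profile[where p = "X(Suc n := x)" and n = "Suc n" and cs = cs, OF this]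
    moreover have "(\<Prod>l\<leftarrow>ls. profile1 x l) = (\<Prod>c\<leftarrow>cs. root_profile M1 V1 (Suc n) (X(Suc n := x)) c)"
      unfolding cs_def by (rule prod_profile_codes(1)[OF _ x]) (rule n)
    ultimately show ?thesis by (simp add: U_def E_def)
  qed
  have 2: "(\<Prod>l\<leftarrow>ls. profile2 y l) = rooted_density M2 V2 U E (Y(Suc n := y))" if y: "y \<in> space M2" for y
  proof -
    have "(Y(Suc n := y)) i \<in> space M2" for i using Y y by simp
    note g2.prod_root_profile[where p = "Y(Suc n := y)" and n = "Suc n" and cs = cs, OF this]
    moreover have "(\<Prod>l\<leftarrow>ls. profile2 y l) = (\<Prod>c\<leftarrow>cs. root_profile M2 V2 (Suc n) (Y(Suc n := y)) c)"
      unfolding cs_def by (rule prod_profile_codes(2)[OF _ y]) (rule n)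
    ultimately show ?thesis by (simp add: U_def E_def)
  qed
  have "same_densities M1 V1 M2 V2 n X Y" by (rule same) (simp add: n_def)
  then have "rooted_density M1 V1 (insert (Suc n) U) (insert (i, Suc n) E) X =
      rooted_density M2 V2 (insert (Suc n) U) (insert (i, Suc n) E) Y"
    using g1.integral_root_edge(2)[where p = X, OF X G i'] by (simp add: same_densities_def)
  then show ?thesis
    using g1.integral_root_edge(1)[where p = X, OF X G i'] g2.integral_root_edge(1)[where p = Y, OF Y G i'] 1 2
    by (simp cong: Bochner_Integration.integral_cong)
qed

lemma distr_profiles: "distr M1 borel profile1 = distr M2 borel profile2"
  by (rule moments_determine_distr[OF _ _ measurable_profiles profiles_unit_interval moments_eq]) unfold_locales

lemma profile_exists: "x \<in> space M1 \<Longrightarrow> \<exists>y\<in>space M2. profile2 y = profile1 x"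
  using approximates_exist profile_approximates by blast

lemma inj_profile1: "inj_on profile1 (space M1)"
  using matched_sequences.inj_profile2[OF matched_sequences_commute[OF matched_sequences_axioms]] .

lemma profile_exists': "y \<in> space M2 \<Longrightarrow> \<exists>x\<in>space M1. profile1 x = profile2 y"
  using matched_sequences.profile_exists[OF matched_sequences_commute[OF matched_sequences_axioms]] .

text \<open>Limits enter only in the existence of \<open>y\<close>. Choosing \<open>y\<close> by its
  profile makes it unique in \<open>space M2\<close>, independent of the approximating sequence, and
  ready for the comparison of distributions.\<close>

definition iso :: "'a \<Rightarrow> 'b" where
  "iso x = (SOME y. y \<in> space M2 \<and> profile2 y = profile1 x)"

lemma iso: "x \<in> space M1 \<Longrightarrow> iso x \<in> space M2" "x \<in> space M1 \<Longrightarrow> profile2 (iso x) = profile1 x"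
  using profile_exists[of x] someI_ex[of "\<lambda>y. y \<in> space M2 \<and> profile2 y = profile1 x"]
  unfolding iso_def by blast+

lemma iso_unique:
  "x \<in> space M1 \<Longrightarrow> y \<in> space M2 \<Longrightarrow> profile2 y = profile1 x \<Longrightarrow> iso x = y"
  using iso[of x] inj_profile2 by (metis inj_onD)

lemma approximates_iso: "x \<in> space M1 \<Longrightarrow> \<exists>s. approximates s x (iso x)"
  using approximates_exist[of x] profile_approximates iso_unique by metis

lemma iso_root: "i \<ge> 1 \<Longrightarrow> iso (X i) = Y i"
  using approximates_iso[OF X] approximates_root iso(1)[OF X] by blast

lemma bij_betw_iso: "bij_betw iso (space M1) (space M2)"
proof (rule bij_betwI')
  show "iso x = iso x' \<longleftrightarrow> x = x'" if "x \<in> space M1" "x' \<in> space M1" for x x'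
    using that iso(2) inj_profile1 by (metis inj_onD)
  show "iso x \<in> space M2" if "x \<in> space M1" for x
    using that by (rule iso)
  show "\<exists>x\<in>space M1. y = iso x" if "y \<in> space M2" for y
    using profile_exists'[OF that] iso_unique that by metis
qed

lemma measure_preserving_iso: "measure_preserving_bij M1 M2 iso"
  using g1.standard g2.standard measurable_profiles distr_profiles inj_profile1 inj_profile2 bij_betw_iso iso(2)
  by (rule measure_preserving_bij_of_equal_distr)

section \<open>Transport of the sections and of the kernel\<close>

lemma measurable_iso: "iso \<in> measurable M1 M2" and distr_iso: "distr M1 M2 iso = M2"
  using measure_preserving_iso by (auto simp: measure_preserving_bij_def)

text \<open>Higher moments of a row itself would need multiple edges. Instead the row weights the
  measure: the weighted distributions of the injective profile have equal moments, and this
  determines the weight almost everywhere.\<close>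

lemma AE_root_row_version:
  assumes i: "i \<ge> 1"
  shows "AE x in M1. V1 (X i) x = V2 (Y i) (iso x)"
proof (rule AE_eq_of_density_distr_eq[OF g1.standard measurable_profiles(1) inj_profile1])
  have u: "V1 (X i) \<in> borel_measurable M1"
    using X by (intro g1.measurable_V_compose) auto
  have V2: "V2 (Y i) \<in> borel_measurable M2"
    using Y by (intro g2.measurable_V_compose) auto
  have v: "(\<lambda>x. V2 (Y i) (iso x)) \<in> borel_measurable M1"
    using measurable_compose[OF measurable_iso V2] .
  show "V1 (X i) \<in> borel_measurable M1" "(\<lambda>x. V2 (Y i) (iso x)) \<in> borel_measurable M1" by fact+
  show "V1 (X i) x \<in> {0..1}" "V2 (Y i) (iso x) \<in> {0..1}" for x
    using g1.range_V g2.range_V by auto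
  have fin: "finite_measure (density M1 w)" if "\<And>x. w x \<in> {0..1}" "w \<in> borel_measurable M1" for w :: "'a \<Rightarrow> real"
  proof (rule finite_measureI)
    have "emeasure (density M1 w) (space M1) = (\<integral>\<^sup>+x. ennreal (w x) * indicator (space M1) x \<partial>M1)"
      using that(2) by (intro emeasure_density) auto
    also have "\<dots> \<le> (\<integral>\<^sup>+x. 1 \<partial>M1)"
      using that(1) by (intro nn_integral_mono) (auto simp: indicator_def)
    also have "\<dots> = 1" by (simp add: g1.emeasure_space_1)
    finally show "emeasure (density M1 w) (space (density M1 w)) \<noteq> \<infinity>"
      by (auto simp: top_unique)
  qed
  have prod_meas: "(\<lambda>x. \<Prod>l\<leftarrow>ls. profile1 x l) \<in> borel_measurable M1"
    "(\<lambda>y. \<Prod>l\<leftarrow>ls. profile2 y l) \<in> borel_measurable M2" for ls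
    by (intro measurable_prod_list measurable_coordinate measurable_profiles)+
  show "distr (density M1 (V1 (X i))) borel profile1 = distr (density M1 (\<lambda>x. V2 (Y i) (iso x))) borel profile1"
  proof (rule moments_determine_distr)
    fix ls
    have "(\<integral>x. (\<Prod>l\<leftarrow>ls. profile1 x l) \<partial>density M1 (V1 (X i))) = (\<integral>x. V1 (X i) x * (\<Prod>l\<leftarrow>ls. profile1 x l) \<partial>M1)"
      using u prod_meas g1.range_V by (subst integral_density) auto
    also have "\<dots> = (\<integral>y. V2 (Y i) y * (\<Prod>l\<leftarrow>ls. profile2 y l) \<partial>distr M1 M2 iso)"
      unfolding distr_iso by (rule root_moments_eq[OF i])
    also have "\<dots> = (\<integral>x. V2 (Y i) (iso x) * (\<Prod>l\<leftarrow>ls. profile2 (iso x) l) \<partial>M1)"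
      using V2 prod_meas by (intro integral_distr measurable_iso) auto
    also have "\<dots> = (\<integral>x. V2 (Y i) (iso x) * (\<Prod>l\<leftarrow>ls. profile1 x l) \<partial>M1)"
      by (intro Bochner_Integration.integral_cong) (simp_all add: iso(2))
    also have "\<dots> = (\<integral>x. (\<Prod>l\<leftarrow>ls. profile1 x l) \<partial>density M1 (\<lambda>x. V2 (Y i) (iso x)))"
      using v prod_meas g2.range_V by (subst integral_density) auto
    finally show "(\<integral>x. (\<Prod>l\<leftarrow>ls. profile1 x l) \<partial>density M1 (V1 (X i))) =
      (\<integral>x. (\<Prod>l\<leftarrow>ls. profile1 x l) \<partial>density M1 (\<lambda>x. V2 (Y i) (iso x)))" .
  qed (use u v g1.range_V g2.range_V measurable_profiles profiles_unit_interval in \<open>auto intro!: fin\<close>)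
qed

lemma AE_root_row:
  assumes i: "i \<ge> 1"
  shows "AE x in M1. W1 (X i) x = W2 (Y i) (iso x)"
proof -
  have "AE y in distr M1 M2 iso. V2 (Y i) y = W2 (Y i) y"
    unfolding distr_iso by (rule g2.AE_V[OF Y])
  then have "AE x in M1. V2 (Y i) (iso x) = W2 (Y i) (iso x)"
    by (rule AE_distrD[OF measurable_iso])
  with AE_root_row_version[OF i] g1.AE_V[OF X[of i]] show ?thesis
    by eventually_elim simp
qed

text \<open>Both \<open>x\<close> and its image are limits of matched roots, whose rows correspond,
  and \<open>iso\<close> preserves \<open>L1\<close> distances of sections. The result holds at
  every \<open>x\<close>, as the prescribed roots require.\<close>

lemma AE_row:
  assumes x: "x \<in> space M1"
  shows "AE z in M1. W1 x z = W2 (iso x) (iso z)"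
proof -
  let ?y = "iso x"
  have y: "?y \<in> space M2" by (rule iso(1)[OF x])
  obtain s where s: "approximates s x ?y" using approximates_iso[OF x] ..
  have W2_iso: "integrable M1 (\<lambda>z. W2 w (iso z))" if "w \<in> space M2" for w
    using integrable_distr[OF measurable_iso, of "W2 w"] g2.integrable_section[OF that] by (simp add: distr_iso)
  have int: "integrable M1 (\<lambda>z. \<bar>W1 x z - W2 ?y (iso z)\<bar>)"
    using g1.integrable_section[OF x] W2_iso[OF y] by auto
  have bound: "(\<integral>z. \<bar>W1 x z - W2 ?y (iso z)\<bar> \<partial>M1) \<le> r1 x (X (s l)) + r2 ?y (Y (s l))" for l
  proof -
    have "s l > l" using s by (simp add: approximates_def)
    then have "AE z in M1. W1 (X (s l)) z = W2 (Y (s l)) (iso z)" by (intro AE_root_row) simp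
    then have "(\<integral>z. \<bar>W1 x z - W2 ?y (iso z)\<bar> \<partial>M1) \<le>
        (\<integral>z. \<bar>W1 x z - W1 (X (s l)) z\<bar> + \<bar>W2 ?y (iso z) - W2 (Y (s l)) (iso z)\<bar> \<partial>M1)"
      using int g1.integrable_section_diff[OF x X] W2_iso[OF y] W2_iso[OF Y]
      by (intro integral_mono_AE) (auto elim!: eventually_mono)
    also have "\<dots> = (\<integral>z. \<bar>W1 x z - W1 (X (s l)) z\<bar> \<partial>M1) + (\<integral>z. \<bar>W2 ?y (iso z) - W2 (Y (s l)) (iso z)\<bar> \<partial>M1)"
      using g1.integrable_section_diff[OF x X] W2_iso[OF y] W2_iso[OF Y] by simp
    also have "(\<integral>z. \<bar>W2 ?y (iso z) - W2 (Y (s l)) (iso z)\<bar> \<partial>M1) =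
        (\<integral>w. \<bar>W2 ?y w - W2 (Y (s l)) w\<bar> \<partial>distr M1 M2 iso)"
      using g2.integrable_section_diff[OF y Y] by (intro integral_distr[symmetric] measurable_iso) auto
    finally show ?thesis by (simp add: graphon_dist_def distr_iso)
  qed
  have "(\<lambda>l. r1 x (X (s l)) + r2 ?y (Y (s l))) \<longlonglongrightarrow> 0 + 0"
    using s by (intro tendsto_add) (auto simp: approximates_def)
  then have "(\<integral>z. \<bar>W1 x z - W2 ?y (iso z)\<bar> \<partial>M1) \<le> 0"
    using bound by (intro LIMSEQ_le_const) auto
  then have "(\<integral>z. \<bar>W1 x z - W2 ?y (iso z)\<bar> \<partial>M1) = 0"
    by (intro order_antisym Bochner_Integration.integral_nonneg) auto
  then have "AE z in M1. \<bar>W1 x z - W2 ?y (iso z)\<bar> = 0"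
    using int by (subst (asm) integral_nonneg_eq_0_iff_AE) auto
  then show ?thesis by eventually_elim simp
qed

text \<open>The rows are assembled for \<open>V1\<close> and \<open>V2\<close>, which are measurable
  on the plain product; only then is \<open>W\<close> restored.\<close>

lemma AE_iso: "AE (x, y) in M1 \<Otimes>\<^sub>M M1. W2 (iso x) (iso y) = W1 x y"
proof -
  interpret pair_sigma_finite M1 M1 ..
  have V2_iso: "(\<lambda>p. V2 (iso (fst p)) (iso (snd p))) \<in> borel_measurable (M1 \<Otimes>\<^sub>M M1)"
    using measurable_iso by (intro g2.measurable_V_compose) auto
  have V1: "(\<lambda>p. V1 (fst p) (snd p)) \<in> borel_measurable (M1 \<Otimes>\<^sub>M M1)"
    by (intro g1.measurable_V_compose) auto
  have "AE x in M1. AE y in M1. V1 x y = V2 (iso x) (iso y)"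
    using AE_space
  proof eventually_elim
    case (elim x)
    have "AE y in distr M1 M2 iso. V2 (iso x) y = W2 (iso x) y"
      unfolding distr_iso by (rule g2.AE_V[OF iso(1)[OF elim]])
    then have "AE y in M1. V2 (iso x) (iso y) = W2 (iso x) (iso y)"
      by (rule AE_distrD[OF measurable_iso])
    with AE_row[OF elim] g1.AE_V[OF elim] show ?case
      by eventually_elim simp
  qed
  then have "AE p in M1 \<Otimes>\<^sub>M M1. V1 (fst p) (snd p) = V2 (iso (fst p)) (iso (snd p))"
    using V1 V2_iso by (intro AE_pair_measure) auto
  moreover have "AE (x, y) in M1 \<Otimes>\<^sub>M M1. (\<lambda>(x, y). V2 x y = W2 x y) (iso x, iso y)"
    using g2.sigma_finite_measure_axioms measurable_iso distr_iso g2.AE_V_pair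
    by (rule AE_pair_pullback)
  ultimately show ?thesis
    using g1.AE_V_pair by eventually_elim (auto simp: case_prod_beta)
qed

end

lemma pure_graphon_version:
  fixes M :: "'a measure"
  assumes "pure_graphon M W"
  shows "\<exists>V. graphon_version M W V"
proof -
  interpret pure_graphon M W by fact
  obtain V :: "'a \<Rightarrow> 'a \<Rightarrow> real" where "(\<lambda>(x, y). V x y) \<in> borel_measurable (M \<Otimes>\<^sub>M M)"
    "\<And>x y. V x y \<in> {0..1}" "\<And>x. x \<in> space M \<Longrightarrow> AE y in M. V x y = W x y"
    by (rule measurable_version) blast
  then have "graphon_version M W V" by unfold_locales
  then show ?thesis by (rule exI[of _ V])
qed

theorem theorem5p2:
  fixes M1 :: "'a measure" and W1 :: "'a \<Rightarrow> 'a \<Rightarrow> real"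
    and M2 :: "'b measure" and W2 :: "'b \<Rightarrow> 'b \<Rightarrow> real"
    and k :: nat and \<alpha>1 :: "nat \<Rightarrow> 'a" and \<alpha>2 :: "nat \<Rightarrow> 'b"
  assumes "pure_graphon M1 W1" and "pure_graphon M2 W2"
    and "\<alpha>1 \<in> {1..k} \<rightarrow> space M1" and "\<alpha>2 \<in> {1..k} \<rightarrow> space M2"
  shows "(\<exists>\<phi>. measure_preserving_bij M1 M2 \<phi> \<and>
            (AE (x, y) in M1 \<Otimes>\<^sub>M M1. W2 (\<phi> x) (\<phi> y) = W1 x y) \<and>
            agree_at_roots M1 W1 W2 k \<alpha>1 \<phi> \<and>
            (\<forall>i\<in>{1..k}. \<phi> (\<alpha>1 i) = \<alpha>2 i))
         \<longleftrightarrow>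
         (\<forall>V E. labeled_simple_graph k V E \<longrightarrow>
            labeled_density M1 W1 k \<alpha>1 V E = labeled_density M2 W2 k \<alpha>2 V E)"
    (is "?iso \<longleftrightarrow> ?dens")
proof
  obtain V1 where g1: "graphon_version M1 W1 V1" using pure_graphon_version[OF assms(1)] ..
  obtain V2 where g2: "graphon_version M2 W2 V2" using pure_graphon_version[OF assms(2)] ..
  show ?dens if ?iso
  proof (intro allI impI)
    fix N E assume "labeled_simple_graph k N E"
    moreover from \<open>?iso\<close> obtain \<phi> where "measure_preserving_bij M1 M2 \<phi>"
      "AE (x, y) in M1 \<Otimes>\<^sub>M M1. W2 (\<phi> x) (\<phi> y) = W1 x y"
      "agree_at_roots M1 W1 W2 k \<alpha>1 \<phi>" "\<forall>i\<in>{1..k}. \<phi> (\<alpha>1 i) = \<alpha>2 i"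
      by blast
    ultimately show "labeled_density M1 W1 k \<alpha>1 N E = labeled_density M2 W2 k \<alpha>2 N E"
      unfolding measure_preserving_bij_def
      by (intro labeled_density_invariant[OF g1 g2, where \<phi> = \<phi>] assms(3,4)) auto
  qed
  show ?iso if dens: ?dens
  proof -
    interpret g1: graphon_version M1 W1 V1 by fact
    interpret g2: graphon_version M2 W2 V2 by fact
    obtain x0 y0 where x0: "x0 \<in> space M1" and y0: "y0 \<in> space M2"
      using g1.not_empty g2.not_empty by blast
    \<comment> \<open>The point \<open>x0\<close> is padding that keeps all values in the space;
      densities with \<open>k\<close> roots do not depend on it.\<close>
    define p where "p i = (if i \<in> {1..k} then \<alpha>1 i else x0)" for i
    define q where "q i = (if i \<in> {1..k} then \<alpha>2 i else y0)" for i
    have pq: "p i \<in> space M1" "q i \<in> space M2" for i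
      unfolding p_def q_def using assms(3,4) x0 y0 by (auto simp: Pi_iff)
    have pq_root: "p i = \<alpha>1 i" "q i = \<alpha>2 i" if "i \<in> {1..k}" for i
      unfolding p_def q_def using that by presburger+
    have "same_densities M1 V1 M2 V2 k p q"
      unfolding same_densities_def
    proof (intro allI impI)
      fix U E assume G: "rooted_graph k U E"
      show "rooted_density M1 V1 U E p = rooted_density M2 V2 U E q"
        using g1.labeled_density_rooted[OF G assms(3) pq_root(1)] g2.labeled_density_rooted[OF G assms(4) pq_root(2)] dens
        by simp
    qed
    then obtain X Y where "matched_sequences M1 W1 V1 M2 W2 V2 k X Y"
      and XY: "\<forall>i\<in>{1..k}. X i = p i \<and> Y i = q i"
      using matched_sequences_exist[OF g1 g2, where p = p and q = q and k = k] pq by blast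
    then interpret matched_sequences M1 W1 V1 M2 W2 V2 k X Y by simp
    have roots: "iso (\<alpha>1 i) = \<alpha>2 i" if "i \<in> {1..k}" for i
    proof -
      have "X i = \<alpha>1 i" "Y i = \<alpha>2 i" "i \<ge> 1" using XY pq_root that by auto
      with iso_root[of i] show ?thesis by simp
    qed
    have row: "AE y in M1. W2 (iso (\<alpha>1 i)) (iso y) = W1 (\<alpha>1 i) y" if "i \<in> {1..k}" for i
    proof -
      have "\<alpha>1 i \<in> space M1" using assms(3) that by (rule Pi_mem)
      from AE_row[OF this] show ?thesis by eventually_elim simp
    qed
    \<comment> \<open>Values at pairs of roots cannot be read off from rows known almost everywhere;
      one-edge graphs supply them.\<close>
    have edge: "W2 (\<alpha>2 i) (\<alpha>2 j) = W1 (\<alpha>1 i) (\<alpha>1 j)" if "i \<in> {1..k}" "j \<in> {1..k}" "i < j" for i j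
      using g1.labeled_density_edge[OF that assms(3)] g2.labeled_density_edge[OF that assms(4)] dens by simp
    have "W2 (iso (\<alpha>1 i)) (iso (\<alpha>1 j)) = W1 (\<alpha>1 i) (\<alpha>1 j)"
      if ij: "i \<in> {1..k}" "j \<in> {1..k}" "i \<noteq> j" for i j
    proof -
      have sp: "\<alpha>1 i \<in> space M1" "\<alpha>1 j \<in> space M1" "\<alpha>2 i \<in> space M2" "\<alpha>2 j \<in> space M2"
        by (fact Pi_mem[OF assms(3) ij(1)] Pi_mem[OF assms(3) ij(2)] Pi_mem[OF assms(4) ij(1)] Pi_mem[OF assms(4) ij(2)])+
      show ?thesis
        unfolding roots[OF ij(1)] roots[OF ij(2)]
        using edge[OF ij(1,2)] edge[OF ij(2,1)] ij(3) g1.symmetric[OF sp(1,2)] g2.symmetric[OF sp(3,4)]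
        by (cases i j rule: linorder_cases) auto
    qed
    then have "agree_at_roots M1 W1 W2 k \<alpha>1 iso"
      using row unfolding agree_at_roots_def by blast
    then show ?thesis
      using measure_preserving_iso AE_iso roots by blast
  qed
qed

end
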